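(* Let $n\geq 5$ be an integer and let $X\subseteq\mathbb{R}^2$ be a set of $n$ points in convex position. Then it cannot happen that every distance determined by $X$, except the diameter of $X$, has multiplicity greater than $n$ in $X$.
   Context: A point set $X\subseteq\mathbb{R}^2$ is convex (in convex position) if no point of $X$ lies in the convex hull of the other points of $X$. For a finite set $X\subseteq\mathbb{R}^2$, a distance determined by $X$ is a value $d>0$ with $d=\mathrm{dist}(x,y)$ (Euclidean distance) for some distinct $x,y\in X$. The multiplicity of $d$ in $X$ is the number of unordered pairs of distinct points of $X$ at distance $d$. The diameter of $X$ is the largest distance determined by $X$. *)

theory Defs
  imports "HOL-Analysis.Analysis"
begin

definition convex_position :: "(real^2) set \<Rightarrow> bool" where
  "convex_position X \<longleftrightarrow> (\<forall>x\<in>X. x \<notin> convex hull (X - {x}))"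

definition determined_distances :: "(real^2) set \<Rightarrow> real set" where
  "determined_distances X = {dist x y | x y. x \<in> X \<and> y \<in> X \<and> x \<noteq> y}"

text \<open>Unordered pairs of distinct points are represented as doubleton sets.\<close>

definition dist_multiplicity :: "(real^2) set \<Rightarrow> real \<Rightarrow> nat" where
  "dist_multiplicity X d =
     card {{x, y} | x y. x \<in> X \<and> y \<in> X \<and> x \<noteq> y \<and> dist x y = d}"

text \<open>The library constant \<^const>\<open>diameter\<close> is a supremum over all pairs of points,
  including equal ones. On a finite set with at least two points it is the largest
  determined distance.\<close>

lemma diameter_eq_Max_determined_distances:
  assumes "finite X" and "card X \<ge> 2"
  shows "diameter X = Max (determined_distances X)"
proof (rule antisym)
  have ne: "X \<noteq> {}" using assms by auto
  have fin: "finite (determined_distances X)"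
    by (rule finite_subset[of _ "(\<lambda>(x, y). dist x y) ` (X \<times> X)"])
       (auto simp: determined_distances_def assms)
  obtain a b where ab: "a \<in> X" "b \<in> X" "a \<noteq> b"
    using assms by (metis card_2_iff' obtain_subset_with_card_n subset_iff)
  then have dab: "dist a b \<in> determined_distances X"
    by (auto simp: determined_distances_def)
  then have M0: "0 \<le> Max (determined_distances X)"
    using Max_ge[OF fin dab] zero_le_dist[of a b] by linarith
  show "diameter X \<le> Max (determined_distances X)"
  proof (rule diameter_le)
    fix x y assume "x \<in> X" "y \<in> X"
    then show "norm (x - y) \<le> Max (determined_distances X)"
      using M0 fin
      by (cases "x = y") (auto simp: determined_distances_def dist_norm intro!: Max_ge)
  qed (use ne in simp)
  show "Max (determined_distances X) \<le> diameter X"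
    using fin dab assms(1)
    by (subst Max_le_iff)
       (auto simp: determined_distances_def intro: diameter_bounded_bound finite_imp_bounded)
qed

end

theory Submission
  imports Defs
begin

text \<open>By Altman's theorem, \<open>2k + 1\<close> points in convex position with at most \<open>k\<close> distances see every
  distance exactly twice from every point. Counting pairs leaves at most \<open>n / 2\<close> distances. For odd
  \<open>n\<close> Altman's theorem gives multiplicity exactly \<open>n\<close>. For even \<open>n\<close> it applies after deleting either
  end of a diameter, and then all other points are equidistant from these two ends, hence collinear.

  For Altman's theorem, start from a vertex and extend a chord \<open>(i, j)\<close> to \<open>(i - 1, j)\<close> or
  \<open>(i, j + 1)\<close> while its length increases; at most \<open>k\<close> steps are possible. Since the bisector of an
  edge separates the vertices into two arcs, the reachable chords are closed under shrinking and are
  described by a monotone function \<open>far\<close>. At the jumps of \<open>far\<close> the polygon turns by at least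
  \<open>2\<pi>/3\<close>, which yields for each point of an orbit of \<open>far\<close> an inequality between lengths of arcs
  of the boundary. Around a periodic orbit these inequalities sum to an equality, and this forces
  \<open>far i = i + k\<close> for every \<open>i\<close>.\<close>

section \<open>Convex polygons\<close>

definition det2 :: "complex \<Rightarrow> complex \<Rightarrow> real"
  where "det2 a b = Re a * Im b - Im a * Re b"

text \<open>Indices run over all integers with period \<open>n\<close>, and \<open>\<theta>\<close>
  lifts the edge directions to the reals, gaining a full turn per period, so that turning angles are
  plain differences. \<open>orient\<close> makes the traversal counterclockwise.\<close>

locale convex_polygon =
  fixes v :: "int \<Rightarrow> complex" and \<theta> :: "int \<Rightarrow> real" and n :: int
  assumes three_le: "3 \<le> n"
    and periodic: "v (i + n) = v i"
    and orient: "\<lbrakk>i < j; j < k; k < i + n\<rbrakk> \<Longrightarrow> 0 < det2 (v j - v i) (v k - v i)"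
    and angle_mono: "i < j \<Longrightarrow> \<theta> i < \<theta> j"
    and angle_periodic: "\<theta> (i + n) = \<theta> i + 2 * pi"
    and edge_polar: "v (i + 1) - v i = complex_of_real (cmod (v (i + 1) - v i)) * cis (\<theta> i)"
begin

definition len :: "int \<Rightarrow> real" where "len g = cmod (v (g + 1) - v g)"

definition dir :: "int \<Rightarrow> complex" where "dir g = cis (\<theta> g)"

text \<open>Coordinate along edge \<open>g\<close>, measured from \<open>v g\<close>: comparing it
  with \<open>len g / 2\<close> tells on which side of the perpendicular bisector of the edge a
  point lies.\<close>

definition proj :: "int \<Rightarrow> complex \<Rightarrow> real" where "proj g x = (x - v g) \<bullet> dir g"

lemma edge: "v (g + 1) = v g + complex_of_real (len g) * dir g"
  unfolding len_def dir_def edge_polar[of g, symmetric] by simp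

lemma vertex_neq:
  assumes "i < j" "j < i + n"
  shows "v i \<noteq> v j"
\<comment> \<open>With a third vertex, \<open>v i = v j\<close> would give a vanishing orientation:
  take the successor of \<open>j\<close>, or \<open>i + 1\<close> if that successor is
  \<open>i\<close> again.\<close>
proof (cases "j + 1 < i + n")
  case True
  then have "0 < det2 (v j - v i) (v (j + 1) - v i)" using assms by (intro orient) auto
  then show ?thesis by (auto simp: det2_def)
next
  case False
  then have "0 < det2 (v (i + 1) - v i) (v j - v i)" using assms three_le by (intro orient) auto
  then show ?thesis by (auto simp: det2_def)
qed

lemma len_pos: "0 < len g"
  using vertex_neq[of g "g + 1"] three_le by (simp add: len_def)

lemma len_periodic: "len (g + n) = len g"
proof -
  have "g + n + 1 = g + 1 + n" by simp
  then show ?thesis by (simp only: len_def periodic)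
qed

lemma norm_dir [simp]: "cmod (dir g) = 1"
  by (simp add: dir_def)

lemma dir_inner: "dir g \<bullet> dir h = cos (\<theta> g - \<theta> h)"
  by (simp add: dir_def inner_complex_def cos_diff)

section \<open>Perpendicular bisectors of edges\<close>

lemma dist_next_vertex:
  "(dist x (v (g + 1)))\<^sup>2 = (dist x (v g))\<^sup>2 + len g * (len g - 2 * proj g x)"
proof -
  have "(dist x (v (g + 1)))\<^sup>2 = (cmod ((x - v g) - len g *\<^sub>R dir g))\<^sup>2"
    unfolding edge by (simp add: dist_norm diff_diff_eq scaleR_conv_of_real)
  also have "\<dots> = (cmod (x - v g))\<^sup>2 - 2 * len g * proj g x + (len g)\<^sup>2 * (cmod (dir g))\<^sup>2"
    unfolding power2_norm_eq_inner proj_def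
    by (simp add: inner_diff inner_commute algebra_simps power2_eq_square)
  finally show ?thesis by (simp add: dist_norm algebra_simps power2_eq_square)
qed

lemma dist_le_iff_proj: "dist x (v g) \<le> dist x (v (g + 1)) \<longleftrightarrow> proj g x \<le> len g / 2"
proof -
  have "dist x (v g) \<le> dist x (v (g + 1)) \<longleftrightarrow> (dist x (v g))\<^sup>2 \<le> (dist x (v (g + 1)))\<^sup>2"
    by (simp add: abs_le_square_iff[symmetric])
  then show ?thesis
    using len_pos[of g] unfolding dist_next_vertex by (auto simp: zero_le_mult_iff)
qed

lemma dist_ge_iff_proj: "dist x (v (g + 1)) \<le> dist x (v g) \<longleftrightarrow> len g / 2 \<le> proj g x"
proof -
  have "dist x (v (g + 1)) \<le> dist x (v g) \<longleftrightarrow> (dist x (v (g + 1)))\<^sup>2 \<le> (dist x (v g))\<^sup>2"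
    by (simp add: abs_le_square_iff[symmetric])
  then show ?thesis
    using len_pos[of g] unfolding dist_next_vertex by (auto simp: mult_le_0_iff)
qed

lemma proj_next: "proj g (v (g + 1)) = len g"
proof -
  have "proj g (v (g + 1)) = (len g *\<^sub>R dir g) \<bullet> dir g"
    unfolding proj_def edge by (simp add: scaleR_conv_of_real)
  then show ?thesis by (simp add: dot_square_norm)
qed

text \<open>Adding the two orientation inequalities at the ends of the edge gives the orientation of the
  two points as seen from its midpoint.\<close>

lemma bisector:
  assumes "g < j" "j < k" "k \<le> g + n" and le: "proj g (v j) \<le> len g / 2"
  shows "proj g (v k) < len g / 2"
proof (cases "k = g + n")
  case True
  then show ?thesis using len_pos[of g] by (simp add: proj_def periodic)
next
  case False
  have "j \<noteq> g + 1"
    using le proj_next[of g] len_pos[of g] by auto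
  then have o1: "0 < det2 (v j - v g) (v k - v g)" and o2: "0 < det2 (v j - v (g + 1)) (v k - v (g + 1))"
    and o3: "0 < det2 (v (g + 1) - v g) (v j - v g)" and o4: "0 < det2 (v (g + 1) - v g) (v k - v g)"
    using assms False by (auto intro!: orient)
  define a b where "a = v j - v g" and "b = v k - v g"
  define c s l where "c = cos (\<theta> g)" and "s = sin (\<theta> g)" and "l = len g"
  have l: "0 < l" using len_pos by (simp add: l_def)
  have cs: "c * c + s * s = 1"
    using sin_cos_squared_add2[of "\<theta> g"] by (simp add: c_def s_def power2_eq_square add.commute)
  have e: "v (g + 1) = v g + Complex (l * c) (l * s)"
    by (simp add: edge l_def c_def s_def dir_def complex_eq_iff)
  have pj: "proj g (v j) = Re a * c + Im a * s" "proj g (v k) = Re b * c + Im b * s"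
    by (simp_all add: proj_def a_def b_def c_def s_def dir_def inner_complex_def)
  \<comment> \<open>Coordinates in the frame of the edge, x along it and y to its left; rotating the
    frame does not change \<open>det2\<close>.\<close>
  define xa ya xb yb where "xa = Re a * c + Im a * s" and "ya = Im a * c - Re a * s"
    and "xb = Re b * c + Im b * s" and "yb = Im b * c - Re b * s"
  have ra: "Re a = xa * c - ya * s" "Im a = xa * s + ya * c" and rb: "Re b = xb * c - yb * s" "Im b = xb * s + yb * c"
    using arg_cong[OF cs, of "\<lambda>t. Re a * t"] arg_cong[OF cs, of "\<lambda>t. Im a * t"]
      arg_cong[OF cs, of "\<lambda>t. Re b * t"] arg_cong[OF cs, of "\<lambda>t. Im b * t"]
    unfolding xa_def ya_def xb_def yb_def by (simp_all add: algebra_simps)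
  have rot: "det2 (Complex (x * c - y * s) (x * s + y * c)) (Complex (x' * c - y' * s) (x' * s + y' * c))
    = x * y' - y * x'" for x y x' y'
  proof -
    have "det2 (Complex (x * c - y * s) (x * s + y * c)) (Complex (x' * c - y' * s) (x' * s + y' * c))
      = (x * y' - y * x') * (c * c + s * s)"
      by (simp add: det2_def algebra_simps)
    then show ?thesis by (simp add: cs)
  qed
  have "a = Complex (xa * c - ya * s) (xa * s + ya * c)" "b = Complex (xb * c - yb * s) (xb * s + yb * c)"
    using ra rb by (simp_all add: complex_eq_iff)
  then have d1: "det2 a b = xa * yb - ya * xb" by (simp only: rot)
  have d2: "det2 (v j - v (g + 1)) (v k - v (g + 1)) = (xa - l) * yb - ya * (xb - l)"
  proof -
    have "v j - v (g + 1) = Complex ((xa - l) * c - ya * s) ((xa - l) * s + ya * c)"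
      "v k - v (g + 1) = Complex ((xb - l) * c - yb * s) ((xb - l) * s + yb * c)"
      using ra rb unfolding e by (simp_all add: a_def b_def complex_eq_iff algebra_simps)
    then show ?thesis by (simp only: rot)
  qed
  have "l * ya > 0" "l * yb > 0"
    using o3 o4 unfolding e by (simp_all add: det2_def ya_def yb_def a_def b_def algebra_simps)
  then have y: "ya > 0" "yb > 0" using l by (simp_all add: zero_less_mult_iff)
  have "0 < (xa - l / 2) * yb - ya * (xb - l / 2)"
    using o1 o2 d1 d2 by (simp add: a_def b_def algebra_simps)
  moreover have "(xa - l / 2) * yb \<le> 0"
    using le y pj by (simp add: xa_def l_def mult_le_0_iff)
  ultimately have "ya * (xb - l / 2) < 0" by linarith
  then show ?thesis using y pj by (simp add: xb_def l_def mult_less_0_iff)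
qed

section \<open>Turning angles of the edges\<close>

lemma vertex_diff_eq_sum:
  assumes "g \<le> h"
  shows "v h - v g = (\<Sum>i\<in>{g..<h}. len i *\<^sub>R dir i)"
  using assms
proof (induction h rule: int_ge_induct)
  case base
  then show ?case by simp
next
  case (step h)
  have "{g..<h + 1} = insert h {g..<h}" using step.hyps by auto
  then have "(\<Sum>i\<in>{g..<h + 1}. len i *\<^sub>R dir i) = len h *\<^sub>R dir h + (v h - v g)"
    using step.IH by simp
  then show ?case unfolding edge[of h] by (simp add: scaleR_conv_of_real)
qed

lemma inner_vertex_diff:
  assumes "g \<le> h"
  shows "(v h - v g) \<bullet> dir e = (\<Sum>i\<in>{g..<h}. len i * cos (\<theta> i - \<theta> e))"
  unfolding vertex_diff_eq_sum[OF assms] by (simp add: inner_sum_left dir_inner)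

lemma angle_le: "i \<le> j \<Longrightarrow> \<theta> i \<le> \<theta> j"
  using angle_mono[of i j] by (cases "i = j") auto

lemma cos_le_minus_half:
  assumes "2 * pi / 3 \<le> t" "t \<le> 4 * pi / 3"
  shows "cos t \<le> - 1 / 2"
proof -
  have "cos (t - pi) \<ge> cos (pi / 3)"
  proof (cases "t \<le> pi")
    case True
    have "cos (t - pi) = cos (pi - t)" by (metis cos_minus minus_diff_eq)
    then show ?thesis using True cos_monotone_0_pi_le[of "pi - t" "pi / 3"] assms by (simp add: field_simps)
  next
    case False
    then show ?thesis using cos_monotone_0_pi_le[of "t - pi" "pi / 3"] assms by (simp add: field_simps)
  qed
  then show ?thesis by (simp add: cos_diff cos_60)
qed

lemma cos_add_cos_pos:
  assumes "0 \<le> s" "0 \<le> t" "s + t < pi"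
  shows "0 < cos s + cos t"
proof -
  have "cos t > cos (pi - s)" using assms by (intro cos_monotone_0_pi) auto
  then show ?thesis by (simp add: cos_diff)
qed

text \<open>Adding the two bisector inequalities for the edges \<open>a\<close> and \<open>c\<close> makes the contribution of every
  intermediate edge positive, so that \<open>1 + 2 cos (\<theta> c - \<theta> a)\<close> cannot be positive.\<close>

lemma wide_turn:
  assumes "a < c"
    and le1: "dist (v a) (v (c + 1)) \<le> dist (v (a + 1)) (v (c + 1))"
    and le2: "dist (v a) (v (c + 1)) \<le> dist (v a) (v c)"
  shows "2 * pi / 3 \<le> \<theta> c - \<theta> a"
proof (rule ccontr)
  define t where "t = \<theta> c - \<theta> a"
  assume "\<not> 2 * pi / 3 \<le> \<theta> c - \<theta> a"
  then have t: "0 < t" "t < 2 * pi / 3" using angle_mono[OF assms(1)] by (auto simp: t_def)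
  have "cos t > cos (2 * pi / 3)" using t by (intro cos_monotone_0_pi) auto
  then have cos_t: "cos t > - 1 / 2" by (simp add: cos_120)
  have "proj a (v (c + 1)) \<le> len a / 2"
    using le1 dist_le_iff_proj[of "v (c + 1)" a] by (simp add: dist_commute)
  then have e1: "(\<Sum>i\<in>{a..<c + 1}. len i * cos (\<theta> i - \<theta> a)) \<le> len a / 2"
    unfolding proj_def using inner_vertex_diff[of a "c + 1" a] assms(1) by simp
  have "len c / 2 \<le> proj c (v a)"
    using le2 dist_ge_iff_proj[of "v a" c] by simp
  moreover have "proj c (v a) = - ((v c - v a) \<bullet> dir c)"
    by (simp add: proj_def inner_diff_left)
  ultimately have e2: "(\<Sum>i\<in>{a..<c}. len i * cos (\<theta> i - \<theta> c)) \<le> - len c / 2"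
    using inner_vertex_diff[of a c c] assms(1) by simp
  have s1: "{a..<c + 1} = insert a (insert c {a + 1..<c})" and s2: "{a..<c} = insert a {a + 1..<c}"
    using assms(1) by auto
  have "\<theta> a - \<theta> c = - t" "\<theta> c - \<theta> a = t" by (simp_all add: t_def)
  then have f1: "len a + len c * cos t + (\<Sum>i\<in>{a + 1..<c}. len i * cos (\<theta> i - \<theta> a)) \<le> len a / 2"
    and f2: "len a * cos t + (\<Sum>i\<in>{a + 1..<c}. len i * cos (\<theta> i - \<theta> c)) \<le> - len c / 2"
    using e1 e2 assms(1) unfolding s1 s2 by (simp_all add: algebra_simps)
  \<comment> \<open>The turns from \<open>a\<close> to \<open>i\<close> and from \<open>i\<close> to
    \<open>c\<close> add up to \<open>t\<close>, which is less than pi, so the two cosines have a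
    positive sum.\<close>
  have "0 \<le> (\<Sum>i\<in>{a + 1..<c}. len i * (cos (\<theta> i - \<theta> a) + cos (\<theta> c - \<theta> i)))"
  proof (intro sum_nonneg mult_nonneg_nonneg)
    fix i assume i: "i \<in> {a + 1..<c}"
    show "0 \<le> len i" using len_pos[of i] by simp
    have "\<theta> a < \<theta> i" "\<theta> i < \<theta> c" using i by (auto intro: angle_mono)
    then show "0 \<le> cos (\<theta> i - \<theta> a) + cos (\<theta> c - \<theta> i)"
      using t by (intro less_imp_le cos_add_cos_pos) (auto simp: t_def)
  qed
  also have "\<dots> = (\<Sum>i\<in>{a + 1..<c}. len i * cos (\<theta> i - \<theta> a)) + (\<Sum>i\<in>{a + 1..<c}. len i * cos (\<theta> i - \<theta> c))"
  proof -
    have "cos (\<theta> c - \<theta> i) = cos (\<theta> i - \<theta> c)" for i by (metis cos_minus minus_diff_eq)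
    then show ?thesis by (simp add: sum.distrib[symmetric] distrib_left)
  qed
  finally have "(len a + len c) * (1 / 2 + cos t) \<le> 0"
    using f1 f2 by (simp add: algebra_simps)
  moreover have "(len a + len c) * (1 / 2 + cos t) > 0"
    using len_pos[of a] len_pos[of c] cos_t by (intro mult_pos_pos) auto
  ultimately show False by simp
qed

text \<open>The orientation of three consecutive vertices has the sign of the sine of the turn, and
  \<open>angle_periodic\<close> keeps the turn below 2 pi.\<close>

lemma turn_less_pi: "\<theta> (g + 1) - \<theta> g < pi"
proof (rule ccontr)
  assume "\<not> \<theta> (g + 1) - \<theta> g < pi"
  moreover have "\<theta> (g + 1) < \<theta> g + 2 * pi"
    using angle_mono[of "g + 1" "g + n"] angle_periodic[of g] three_le by simp
  ultimately have "sin (\<theta> (g + 1) - \<theta> g - pi) \<ge> 0" by (intro sin_ge_zero) auto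
  then have s: "sin (\<theta> (g + 1) - \<theta> g) \<le> 0" by (simp add: sin_diff)
  have "0 < det2 (v (g + 1) - v g) (v (g + 1 + 1) - v g)" using three_le by (intro orient) auto
  also have "\<dots> = len g * len (g + 1) * sin (\<theta> (g + 1) - \<theta> g)"
    unfolding edge by (simp add: det2_def dir_def sin_diff algebra_simps)
  finally show False using s len_pos[of g] len_pos[of "g + 1"]
    by (metis less_le_not_le mult_pos_pos mult_nonneg_nonpos less_imp_le)
qed

text \<open>\<open>proj g (v y) - len g\<close> is the component along edge \<open>g\<close> of the
  vector \<open>w\<close> from \<open>v (g + 1)\<close> to \<open>v y\<close>. Passing to edge
  \<open>g + 1\<close> rotates the direction towards \<open>w\<close> and not beyond it, so the
  component grows.\<close>

lemma proj_rotate: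
  assumes "g + 1 < y" "y < g + n"
  shows "proj g (v y) - len g < proj (g + 1) (v y)"
proof -
  define w where "w = v y - v (g + 1)"
  define t where "t = \<theta> (g + 1) - \<theta> g"
  define c s where "c = cos (\<theta> g)" and "s = sin (\<theta> g)"
  have t: "0 < t" "t < pi" using angle_mono[of g "g + 1"] turn_less_pi[of g] by (auto simp: t_def)
  have cs: "c * c + s * s = 1"
    using sin_cos_squared_add2[of "\<theta> g"] by (simp add: c_def s_def power2_eq_square add.commute)
  have "0 < det2 (v (g + 1) - v g) (v y - v g)" using assms by (intro orient) auto
  also have "\<dots> = len g * det2 (dir g) w"
    unfolding w_def edge by (simp add: det2_def algebra_simps)
  finally have d1: "0 < det2 (dir g) w" using len_pos[of g] by (simp add: zero_less_mult_iff)
  have d2: "0 \<le> det2 (dir (g + 1)) w"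
  proof (cases "y = g + 1 + 1")
    case True
    then show ?thesis unfolding w_def True edge[of "g + 1"] by (simp add: det2_def algebra_simps)
  next
    case False
    then have "0 < det2 (v (g + 1 + 1) - v (g + 1)) (v y - v (g + 1))" using assms by (intro orient) auto
    also have "\<dots> = len (g + 1) * det2 (dir (g + 1)) w"
      unfolding w_def edge[of "g + 1"] by (simp add: det2_def algebra_simps)
    finally show ?thesis using len_pos[of "g + 1"] by (simp add: zero_less_mult_iff)
  qed
  define p q where "p = Re w * c + Im w * s" and "q = c * Im w - s * Re w"
  have th: "\<theta> (g + 1) = \<theta> g + t" by (simp add: t_def)
  have q: "det2 (dir g) w = q" by (simp add: det2_def dir_def q_def c_def s_def)
  have "det2 (dir (g + 1)) w = q * cos t - p * sin t"
    unfolding dir_def th by (simp add: det2_def cos_add sin_add q_def p_def c_def s_def algebra_simps)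
  then have d2': "0 \<le> q * cos t - p * sin t" using d2 by simp
  have in1: "w \<bullet> dir g = p" by (simp add: inner_complex_def dir_def p_def c_def s_def)
  have in2: "w \<bullet> dir (g + 1) = p * cos t + q * sin t"
    unfolding dir_def th
    by (simp add: inner_complex_def cos_add sin_add q_def p_def c_def s_def algebra_simps)
  have st: "0 < sin t" using t by (intro sin_gt_zero) auto
  have ct: "cos t < 1" using t cos_monotone_0_pi[of 0 t] by simp
  \<comment> \<open>To be read with \<open>C = cos t\<close> and \<open>S = sin t\<close>: the last
    summand vanishes, and the first is positive by the signs of \<open>q = det2 (dir g) w\<close>
    and \<open>q * C - p * S = det2 (dir (g + 1)) w\<close>.\<close>
  have "S * (p * C + q * S - p) = (1 - C) * (q * C - p * S + q) + q * (C\<^sup>2 + S\<^sup>2 - 1)" for C S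
    by (simp add: algebra_simps power2_eq_square)
  then have "sin t * (p * cos t + q * sin t - p) = (1 - cos t) * (q * cos t - p * sin t + q)
     + q * ((cos t)\<^sup>2 + (sin t)\<^sup>2 - 1)" .
  also have "\<dots> = (1 - cos t) * (q * cos t - p * sin t + q)" by simp
  also have "\<dots> > 0" using ct d2' d1 q by (intro mult_pos_pos) auto
  finally have "p < p * cos t + q * sin t" using st by (simp add: zero_less_mult_iff)
  moreover have "proj (g + 1) (v y) = w \<bullet> dir (g + 1)" by (simp add: proj_def w_def)
  moreover have "proj g (v y) - len g = w \<bullet> dir g"
    using proj_next[of g] by (simp add: proj_def w_def inner_diff_left)
  ultimately show ?thesis using in1 in2 by simp
qed

lemma proj_rotate_sum:
  assumes "b \<le> e" "e < y" "y < b + n"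
  shows "proj b (v y) - (\<Sum>g\<in>{b..<e}. len g) \<le> proj e (v y)"
    and "b < e \<Longrightarrow> proj b (v y) - (\<Sum>g\<in>{b..<e}. len g) < proj e (v y)"
proof -
  have "proj b (v y) - (\<Sum>g\<in>{b..<e}. len g) \<le> proj e (v y) \<and>
    (b < e \<longrightarrow> proj b (v y) - (\<Sum>g\<in>{b..<e}. len g) < proj e (v y))"
    using assms(1,2)
  proof (induction e rule: int_ge_induct)
    case base
    then show ?case by simp
  next
    case (step e)
    have "{b..<e + 1} = insert e {b..<e}" using step.hyps by auto
    moreover have "proj e (v y) - len e < proj (e + 1) (v y)"
      using step assms(3) by (intro proj_rotate) auto
    ultimately show ?case using step by simp
  qed
  then show "proj b (v y) - (\<Sum>g\<in>{b..<e}. len g) \<le> proj e (v y)"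
    and "b < e \<Longrightarrow> proj b (v y) - (\<Sum>g\<in>{b..<e}. len g) < proj e (v y)" by auto
qed

end

section \<open>Chords reachable by increasing length\<close>

text \<open>The hypotheses of Altman's theorem. \<open>D\<close> is any set containing the
  distances, so one set can serve for several polygons.\<close>

locale few_distances = convex_polygon +
  fixes D :: "real set"
  assumes finite_D: "finite D"
    and dist_in_D: "v i \<noteq> v j \<Longrightarrow> dist (v i) (v j) \<in> D"
    and card_D: "2 * int (card D) < n"
begin

abbreviation d :: "int \<Rightarrow> int \<Rightarrow> real" where "d i j \<equiv> dist (v i) (v j)"

inductive reach :: "int \<Rightarrow> int \<Rightarrow> bool" where
  refl: "reach i i"
| left: "reach i j \<Longrightarrow> d i j < d (i - 1) j \<Longrightarrow> reach (i - 1) j"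
| right: "reach i j \<Longrightarrow> d i j < d i (j + 1) \<Longrightarrow> reach i (j + 1)"

lemma card_below_less:
  assumes "x < y" "y \<in> D"
  shows "card {t \<in> D. t \<le> x} < card {t \<in> D. t \<le> y}"
proof (rule psubset_card_mono)
  have "y \<in> {t \<in> D. t \<le> y} - {t \<in> D. t \<le> x}" using assms by simp
  moreover have "{t \<in> D. t \<le> x} \<subseteq> {t \<in> D. t \<le> y}" using assms(1) by auto
  ultimately show "{t \<in> D. t \<le> x} \<subset> {t \<in> D. t \<le> y}" by blast
qed (simp add: finite_D)

lemma dist_in_D_if_less: "x < d i j \<Longrightarrow> 0 \<le> x \<Longrightarrow> d i j \<in> D"
  using dist_in_D[of i j] by force

text \<open>Each extension moves to a strictly larger element of \<open>D\<close>, so the rank of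
  the chord length in \<open>D\<close> bounds the number of extensions, which is
  \<open>j - i\<close>.\<close>

lemma reach_le_card: "reach i j \<Longrightarrow> i \<le> j \<and> j - i \<le> int (card {t \<in> D. t \<le> d i j})"
proof (induction rule: reach.induct)
  case (left i j)
  then have "card {t \<in> D. t \<le> d i j} < card {t \<in> D. t \<le> d (i - 1) j}"
    by (intro card_below_less dist_in_D_if_less[of "d i j"]) auto
  then show ?case using left by linarith
next
  case (right i j)
  then have "card {t \<in> D. t \<le> d i j} < card {t \<in> D. t \<le> d i (j + 1)}"
    by (intro card_below_less dist_in_D_if_less[of "d i j"]) auto
  then show ?case using right by linarith
qed simp

lemma reach_le: "reach i j \<Longrightarrow> i \<le> j"
  and reach_span: "reach i j \<Longrightarrow> j \<le> i + int (card D)"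
proof -
  assume r: "reach i j"
  show "i \<le> j" using reach_le_card[OF r] by simp
  have "card {t \<in> D. t \<le> d i j} \<le> card D" using finite_D by (intro card_mono) auto
  then show "j \<le> i + int (card D)" using reach_le_card[OF r] by linarith
qed

text \<open>By \<open>bisector\<close>, the vertices nearer to \<open>v i\<close> than to
  \<open>v (i - 1)\<close> form an arc starting at \<open>i\<close>, which contains \<open>b\<close>
  along with \<open>j\<close>.\<close>

lemma left_shrink:
  assumes "i \<le> b" "b \<le> j" "j < i + n" "d i j < d (i - 1) j"
  shows "d i b < d (i - 1) b"
proof (rule ccontr)
  assume *: "\<not> d i b < d (i - 1) b"
  then have "b < j" using assms by (cases "b = j") auto
  have "proj (i - 1) (v b) \<le> len (i - 1) / 2"
    using * dist_le_iff_proj[of "v b" "i - 1"] by (simp add: dist_commute)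
  then have "proj (i - 1) (v j) < len (i - 1) / 2"
    using bisector[of "i - 1" b j] \<open>b < j\<close> assms by simp
  then show False
    using assms(4) dist_le_iff_proj[of "v j" "i - 1"] by (simp add: dist_commute)
qed

text \<open>Mirror image of \<open>left_shrink\<close>. \<open>bisector\<close> runs forward from
  edge \<open>j\<close>, hence the passage from \<open>i\<close> and \<open>a\<close> to
  \<open>i + n\<close> and \<open>a + n\<close>.\<close>

lemma right_shrink:
  assumes "i \<le> a" "a \<le> j" "j < i + n" "d i j < d i (j + 1)"
  shows "d a j < d a (j + 1)"
proof (cases "a = i")
  case False
  have "proj j (v (i + n)) \<le> len j / 2"
    using assms(4) dist_le_iff_proj[of "v i" j] by (simp add: periodic)
  then have "proj j (v (a + n)) < len j / 2"
    using bisector[of j "i + n" "a + n"] False assms by simp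
  then show ?thesis
    using dist_ge_iff_proj[of "v a" j] by (simp add: periodic)
qed (use assms in simp)

lemma span_less_period: "reach i j \<Longrightarrow> j < i + n"
  using reach_span[of i j] card_D by simp

text \<open>By \<open>right_shrink\<close>, a last extension at the right end also lengthens the
  shortened chord, so it can be repeated there.\<close>

lemma reach_shrink_left: "reach i j \<Longrightarrow> i \<le> a \<Longrightarrow> a \<le> j \<Longrightarrow> reach a j"
proof (induction arbitrary: a rule: reach.induct)
  case (refl i)
  then show ?case by (metis reach.refl order_antisym)
next
  case (left i j)
  then show ?case by (cases "a = i - 1") (auto intro: reach.left)
next
  case (right i j)
  show ?case
  proof (cases "a = j + 1")
    case False
    then have "a \<le> j" using right by simp
    then show ?thesis
      using right right_shrink[of i a j] span_less_period[of i j] by (auto intro: reach.right)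
  qed (auto intro: reach.refl)
qed

lemma reach_shrink_right: "reach i j \<Longrightarrow> i \<le> b \<Longrightarrow> b \<le> j \<Longrightarrow> reach i b"
proof (induction arbitrary: b rule: reach.induct)
  case (refl i)
  then show ?case by (metis reach.refl order_antisym)
next
  case (left i j)
  show ?case
  proof (cases "b = i - 1")
    case False
    then have "i \<le> b" using left by simp
    then show ?thesis
      using left left_shrink[of i b j] span_less_period[of i j] by (auto intro: reach.left)
  qed (auto intro: reach.refl)
next
  case (right i j)
  then show ?case by (cases "b = j + 1") (auto intro: reach.right)
qed

lemma periodic_mult: "v (i + s * n) = v i"
proof -
  have nat: "v (i + int m * n) = v i" for m i
  proof (induction m)
    case (Suc m)
    have "i + int (Suc m) * n = i + int m * n + n" by (simp add: algebra_simps)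
    then show ?case using Suc periodic[of "i + int m * n"] by (simp only:)
  qed simp
  show ?thesis
  proof (cases "s \<ge> 0")
    case True
    then show ?thesis using nat[of i "nat s"] by simp
  next
    case False
    then show ?thesis using nat[of "i + s * n" "nat (- s)"] by simp
  qed
qed

lemma reach_shift: "reach i j \<Longrightarrow> reach (i + s * n) (j + s * n)"
proof (induction rule: reach.induct)
  case (left i j)
  have "i - 1 + s * n = i + s * n - 1" by simp
  moreover have "v (i + s * n - 1) = v (i - 1)" using periodic_mult[of "i - 1" s] by (simp add: algebra_simps)
  ultimately show ?case using left by (metis periodic_mult reach.left)
next
  case (right i j)
  have "j + 1 + s * n = j + s * n + 1" by simp
  moreover have "v (j + s * n + 1) = v (j + 1)" using periodic_mult[of "j + 1" s] by (simp add: algebra_simps)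
  ultimately show ?case using right by (metis periodic_mult reach.right)
qed (rule reach.refl)

section \<open>The farthest reachable vertex and its levels\<close>

definition far :: "int \<Rightarrow> int" where "far i = Max {j. reach i j}"

lemma finite_reach: "finite {j. reach i j}"
  by (rule finite_subset[of _ "{i..i + int (card D)}"]) (auto dest: reach_le reach_span)

lemma reach_far: "reach i (far i)"
  using Max_in[OF finite_reach, of i] reach.refl[of i] unfolding far_def by blast

lemma le_far: "reach i j \<Longrightarrow> j \<le> far i"
  unfolding far_def using finite_reach by (intro Max_ge) auto

lemma far_le: "far i \<le> i + int (card D)"
  using reach_span reach_far by blast

lemma less_far: "i < far i"
proof -
  have "reach i (i + 1)"
    using reach.right[OF reach.refl[of i]] vertex_neq[of i "i + 1"] three_le by simp
  then show ?thesis using le_far[of i "i + 1"] by simp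
qed

lemma far_step: "far i \<le> far (i + 1)"
  using reach_shrink_left[OF reach_far[of i], of "i + 1"] less_far[of i] by (intro le_far) auto

lemma far_mono: "i \<le> j \<Longrightarrow> far i \<le> far j"
proof (induction j rule: int_ge_induct)
  case (step j)
  then show ?case using far_step[of j] by simp
qed simp

lemma far_shift: "far (i + s * n) = far i + s * n"
proof (rule antisym)
  show "far i + s * n \<le> far (i + s * n)" by (rule le_far[OF reach_shift[OF reach_far]])
  have "reach i (far (i + s * n) - s * n)"
    using reach_shift[OF reach_far[of "i + s * n"], of "- s"] by simp
  then show "far (i + s * n) \<le> far i + s * n" using le_far by fastforce
qed

lemma far_barrier_right: "d i (far i + 1) \<le> d i (far i)"
  using reach.right[OF reach_far[of i]] le_far[of i "far i + 1"] by fastforce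

text \<open>The jump makes the chord from \<open>i + 1\<close> to \<open>far i + 1\<close>
  reachable; were its extension to \<open>i\<close> longer, \<open>far i\<close> would not be
  maximal.\<close>

lemma far_barrier_left:
  assumes "far i < far (i + 1)"
  shows "d i (far i + 1) \<le> d (i + 1) (far i + 1)"
proof (rule ccontr)
  assume *: "\<not> ?thesis"
  have "reach (i + 1) (far i + 1)"
    using reach_shrink_right[OF reach_far[of "i + 1"], of "far i + 1"] assms less_far[of i] by simp
  then have "reach i (far i + 1)" using reach.left[of "i + 1" "far i + 1"] * by simp
  then show False using le_far[of i "far i + 1"] by simp
qed

text \<open>\<open>far\<close> jumps right after this index, so both barriers apply to the chord
  from \<open>level_end a\<close> to \<open>far a + 1\<close>.\<close>

definition level_end :: "int \<Rightarrow> int" where "level_end a = Max {i. far i = far a}"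

lemma finite_same_far: "finite {i. far i = far a}"
proof (rule finite_subset[of _ "{far a - int (card D)..far a}"])
  show "{i. far i = far a} \<subseteq> {far a - int (card D)..far a}"
  proof
    fix i assume "i \<in> {i. far i = far a}"
    then show "i \<in> {far a - int (card D)..far a}" using far_le[of i] less_far[of i] by auto
  qed
qed simp

lemma far_level_end: "far (level_end a) = far a"
  using Max_in[OF finite_same_far[of a]] unfolding level_end_def by blast

lemma le_level_end: "far i = far a \<Longrightarrow> i \<le> level_end a"
  unfolding level_end_def using finite_same_far by (intro Max_ge) auto

lemma self_le_level_end: "a \<le> level_end a"
  by (simp add: le_level_end)

lemma level_end_less_far: "level_end a < far a"
  using less_far[of "level_end a"] by (simp add: far_level_end)

lemma far_after_level_end: "far a < far (level_end a + 1)"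
  using far_step[of "level_end a"] le_level_end[of "level_end a + 1" a] by (fastforce simp: far_level_end)

lemma level_end_less: "far a < far b \<Longrightarrow> level_end a < b"
  using far_mono[of b "level_end a"] by (fastforce simp: far_level_end)

lemma level_end_shift: "level_end (a + s * n) = level_end a + s * n"
proof (rule antisym)
  show "level_end a + s * n \<le> level_end (a + s * n)" by (rule le_level_end) (simp add: far_shift far_level_end)
  have "far (level_end (a + s * n) - s * n) = far a"
    using far_shift[of "level_end (a + s * n) - s * n" s] far_level_end[of "a + s * n"] far_shift[of a s] by simp
  then show "level_end (a + s * n) \<le> level_end a + s * n" using le_level_end by fastforce
qed

text \<open>By the two barriers the chord from \<open>level_end a\<close> to
  \<open>far a + 1\<close> is no longer than the chords obtained by moving one end inwards, as
  \<open>wide_turn\<close> requires.\<close>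

lemma wide_turn_level_end: "2 * pi / 3 \<le> \<theta> (far a) - \<theta> (level_end a)"
  using wide_turn[of "level_end a" "far a"] far_barrier_right[of "level_end a"] far_barrier_left[of "level_end a"]
    far_after_level_end[of a] level_end_less_far[of a] by (simp add: far_level_end)

lemma far_far_less: "far (far a) < a + n"
  using far_le[of a] far_le[of "far a"] card_D by simp

lemma level_end_less_period: "level_end (far (far a)) < a + n"
proof (rule level_end_less)
  have "far (far (far a)) < far a + n" by (rule far_far_less)
  then show "far (far (far a)) < far (a + n)" using far_shift[of a 1] by simp
qed

text \<open>Seen from the edges between \<open>far a\<close> and \<open>level_end (far a)\<close>, all the edges on the opposite side
  turn by at least \<open>2\<pi>/3\<close> in both directions.\<close>

lemma outer_sum_le:
  fixes a :: int
  defines "b \<equiv> far a"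
  defines "c \<equiv> far b"
  shows "sum len {c + 1..<level_end a + n} \<le> 2 * sum len {b..level_end b} - len b - len (level_end b)"
    and "b < level_end b \<Longrightarrow> sum len {c + 1..<level_end a + n} < 2 * sum len {b..level_end b} - len b - len (level_end b)"
proof -
  \<comment> \<open>\<open>y\<close> is \<open>level_end a\<close> one period later, so that it
    comes after \<open>b\<close>, \<open>e\<close> and \<open>c\<close>.\<close>
  define e y where "e = level_end b" and "y = level_end a + n"
  have cy: "c + 1 \<le> y"
    using far_far_less[of a] self_le_level_end[of a] by (simp add: b_def c_def y_def)
  have be: "b \<le> e" and ec: "e < c" and yb: "y < b + n"
    using self_le_level_end[of b] level_end_less_far[of b] level_end_less_far[of a] by (simp_all add: e_def c_def y_def b_def)
  have "len b / 2 \<le> proj b (v (level_end a))"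
    using far_barrier_right[of "level_end a"] dist_ge_iff_proj[of "v (level_end a)" b] by (simp add: far_level_end b_def)
  then have p1: "len b / 2 \<le> proj b (v y)" by (simp add: y_def periodic)
  have "d e (c + 1) \<le> d (e + 1) (c + 1)"
    using far_barrier_left[of e] far_after_level_end[of b] by (simp add: far_level_end e_def c_def)
  then have p2: "proj e (v (c + 1)) \<le> len e / 2"
    using dist_le_iff_proj[of "v (c + 1)" e] by (simp add: dist_commute)
  \<comment> \<open>A turn between 2 pi/3 and 4 pi/3 has cosine at most -1/2, so each outer edge
    moves back in direction \<open>e\<close> by at least half its length.\<close>
  have "(\<Sum>g\<in>{c + 1..<y}. len g * cos (\<theta> g - \<theta> e)) \<le> (\<Sum>g\<in>{c + 1..<y}. len g * (- 1 / 2))"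
  proof (intro sum_mono mult_left_mono cos_le_minus_half)
    fix g assume g: "g \<in> {c + 1..<y}"
    show "0 \<le> len g" using len_pos[of g] by simp
    have "\<theta> c \<le> \<theta> g" using g by (intro angle_le) auto
    moreover have "2 * pi / 3 \<le> \<theta> c - \<theta> e" using wide_turn_level_end[of b] by (simp add: c_def e_def)
    ultimately show "2 * pi / 3 \<le> \<theta> g - \<theta> e" by simp
    have "\<theta> g \<le> \<theta> y" using g by (intro angle_le) auto
    also have "\<theta> y = \<theta> (level_end a) + 2 * pi" by (simp add: y_def angle_periodic)
    finally have "\<theta> g \<le> \<theta> (level_end a) + 2 * pi" .
    moreover have "2 * pi / 3 \<le> \<theta> b - \<theta> (level_end a)" using wide_turn_level_end[of a] by (simp add: b_def)
    moreover have "\<theta> b \<le> \<theta> e" using be by (rule angle_le)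
    ultimately show "\<theta> g - \<theta> e \<le> 4 * pi / 3" by simp
  qed
  then have out: "(v y - v (c + 1)) \<bullet> dir e \<le> - sum len {c + 1..<y} / 2"
    using inner_vertex_diff[OF cy, of e] by (simp add: sum_divide_distrib sum_negf)
  have "proj e (v y) = proj e (v (c + 1)) + (v y - v (c + 1)) \<bullet> dir e"
    by (simp add: proj_def inner_diff_left)
  then have p3: "proj e (v y) \<le> len e / 2 - sum len {c + 1..<y} / 2"
    using p2 out by simp
  have "{b..e} = insert e {b..<e}" using be by auto
  then have s: "sum len {b..e} = len e + sum len {b..<e}" by simp
  have ey: "e < y" using ec cy by simp
  \<comment> \<open>Rotating the direction from \<open>b\<close> to \<open>e\<close> costs at most
    the length of the edges in between, which links the lower bound \<open>p1\<close> to the upper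
    bound \<open>p3\<close>.\<close>
  show "sum len {c + 1..<level_end a + n} \<le> 2 * sum len {b..level_end b} - len b - len (level_end b)"
    using proj_rotate_sum(1)[OF be ey yb] p1 p3 s by (simp add: e_def y_def)
  show "sum len {c + 1..<level_end a + n} < 2 * sum len {b..level_end b} - len b - len (level_end b)" if "b < level_end b"
    using proj_rotate_sum(2)[OF be ey yb] that p1 p3 s by (simp add: e_def y_def)
qed

section \<open>Boundary lengths of the levels\<close>

definition side :: "int \<Rightarrow> real" where "side a = sum len {a..level_end a}"

lemma len_shift: "len (g + s * n) = len g"
  using periodic_mult[of g s] periodic_mult[of "g + 1" s] by (simp add: len_def algebra_simps)

lemma side_shift: "side (a + s * n) = side a"
proof -
  have "side (a + s * n) = sum len ((\<lambda>g. g + s * n) ` {a..level_end a})"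
    unfolding side_def level_end_shift by (simp add: image_add_atLeastAtMost' add.commute)
  also have "\<dots> = side a"
    by (subst sum.reindex) (auto simp: side_def len_shift inj_on_def)
  finally show ?thesis .
qed

lemma side_eq_first: "side a = len a + sum len {a + 1..level_end a}"
proof -
  have "{a..level_end a} = insert a {a + 1..level_end a}" using self_le_level_end[of a] by auto
  then show ?thesis by (simp add: side_def)
qed

lemma side_eq_level_end: "side a = len (level_end a) + sum len {a..<level_end a}"
proof -
  have "{a..level_end a} = insert (level_end a) {a..<level_end a}" using self_le_level_end[of a] by auto
  then show ?thesis by (simp add: side_def)
qed

text \<open>The side at \<open>far (far a)\<close> without its first edge and the side at
  \<open>a\<close>, moved on by one period, without its last edge are disjoint pieces of the outer
  arc.\<close>

lemma side_sum_le_outer: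
  "side (far (far a)) - len (far (far a)) + (side a - len (level_end a))
     \<le> sum len {far (far a) + 1..<level_end a + n}"
proof -
  let ?c = "far (far a)"
  have "sum len {a..<level_end a} = sum len ((\<lambda>g. g + n) ` {a..<level_end a})"
    by (subst sum.reindex) (auto simp: len_periodic inj_on_def)
  then have "side ?c - len ?c + (side a - len (level_end a))
      = sum len {?c + 1..level_end ?c} + sum len {a + n..<level_end a + n}"
    by (simp add: side_eq_first[of ?c] side_eq_level_end[of a] add.commute)
  also have "\<dots> = sum len ({?c + 1..level_end ?c} \<union> {a + n..<level_end a + n})"
    using level_end_less_period[of a] by (subst sum.union_disjoint) auto
  also have "\<dots> \<le> sum len {?c + 1..<level_end a + n}"
    using level_end_less_period[of a] far_far_less[of a] self_le_level_end[of a]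
    by (intro sum_mono2) (auto intro: less_imp_le len_pos)
  finally show ?thesis .
qed

end

section \<open>Periodic orbits\<close>

text \<open>Each unit shift drops one term and picks up an equal one a period later.\<close>

lemma sum_periodic_shift:
  fixes F :: "nat \<Rightarrow> 'a::ab_group_add"
  assumes "\<And>m. F (m + r) = F m"
  shows "(\<Sum>m<r. F (m + s)) = (\<Sum>m<r. F m)"
proof (induction s)
  case (Suc s)
  have "(\<Sum>m<Suc r. F (m + s)) = F s + (\<Sum>m<r. F (Suc m + s))"
    by (subst sum.lessThan_Suc_shift) simp
  moreover have "F (r + s) = F s" using assms[of s] by (simp add: add.commute)
  ultimately have "(\<Sum>m<r. F (m + s)) = (\<Sum>m<r. F (Suc m + s))" by (simp add: add.commute)
  then show ?case using Suc by simp
qed simp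

context few_distances begin

text \<open>\<open>far\<close> commutes with shifts by \<open>n\<close> and so acts on residues
  modulo \<open>n\<close>; these are the periodic points of that action.\<close>

definition far_periodic :: "int \<Rightarrow> bool"
  where "far_periodic a \<longleftrightarrow> (\<exists>r w. 0 < r \<and> (far ^^ r) a = a + w * n)"

lemma funpow_far_shift: "(far ^^ m) (a + s * n) = (far ^^ m) a + s * n"
  by (induction m) (simp_all add: far_shift)

lemma far_periodic_shift: "far_periodic a \<Longrightarrow> far_periodic (a + s * n)"
  unfolding far_periodic_def by (force simp: funpow_far_shift)

lemma far_periodic_far: "far_periodic a \<Longrightarrow> far_periodic (far a)"
  unfolding far_periodic_def by (metis far_shift funpow_swap1)

text \<open>Pigeonhole: the iterates of \<open>far\<close> at 0 take only \<open>n\<close> residues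
  modulo \<open>n\<close>, so two of them agree.\<close>

lemma ex_far_periodic: "\<exists>a. far_periodic a"
proof -
  define f where "f m = (far ^^ m) 0 mod n" for m
  have "range f \<subseteq> {0..<n}" using three_le by (auto simp: f_def)
  then have "finite (range f)" by (rule finite_subset) simp
  then have "\<not> inj f" using finite_imageD[of f UNIV] by auto
  then obtain i j where "i < j" "f i = f j" unfolding inj_def by (metis linorder_neq_iff)
  then have "n dvd (far ^^ j) 0 - (far ^^ i) 0" by (simp add: f_def mod_eq_dvd_iff[symmetric])
  then obtain w where "(far ^^ j) 0 - (far ^^ i) 0 = n * w" by (elim dvdE)
  moreover have "(far ^^ j) 0 = (far ^^ (j - i)) ((far ^^ i) 0)"
    using \<open>i < j\<close> by (metis add_diff_inverse_nat comp_apply funpow_add add.commute less_imp_not_less)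
  ultimately have "(far ^^ (j - i)) ((far ^^ i) 0) = (far ^^ i) 0 + w * n"
    by (simp add: algebra_simps)
  then show ?thesis using \<open>i < j\<close> unfolding far_periodic_def by (metis zero_less_diff)
qed

text \<open>Summing the inequality of \<open>outer_sum_le\<close> over a periodic orbit of \<open>far\<close>, both sides agree, so
  no strict inequality can occur.\<close>

lemma level_end_far_periodic:
  assumes "far_periodic a"
  shows "level_end (far a) = far a"
proof (rule ccontr)
  assume "level_end (far a) \<noteq> far a"
  then have strict: "far a < level_end (far a)" using self_le_level_end[of "far a"] by simp
  obtain r w where r: "0 < r" "(far ^^ r) a = a + w * n" using assms by (auto simp: far_periodic_def)
  define p where "p m = (far ^^ m) a" for m
  have p_r: "p (m + r) = p m + w * n" for m
    unfolding p_def by (simp add: funpow_add r(2) funpow_far_shift)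
  \<comment> \<open>\<open>F1\<close> leaves out the first edge of a side and \<open>F2\<close> the
    last; in these terms \<open>side_sum_le_outer\<close> and \<open>outer_sum_le\<close> chain
    together.\<close>
  define F1 F2 where "F1 m = side (p m) - len (p m)" and "F2 m = side (p m) - len (level_end (p m))" for m
  have per: "F1 (m + r) = F1 m" "F2 (m + r) = F2 m" for m
    by (simp_all add: F1_def F2_def p_r side_shift len_shift level_end_shift)
  have p1: "p (m + 1) = far (p m)" and p2: "p (m + 2) = far (far (p m))" for m
    by (simp_all add: p_def)
  have out: "F1 (m + 2) + F2 m \<le> F1 (m + 1) + F2 (m + 1)" for m
    using side_sum_le_outer[of "p m"] outer_sum_le(1)[of "p m"]
    unfolding F1_def F2_def p1 p2 side_def by simp
  have "F1 (0 + 2) + F2 0 < F1 (0 + 1) + F2 (0 + 1)"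
    using side_sum_le_outer[of "p 0"] outer_sum_le(2)[of "p 0"] strict
    unfolding F1_def F2_def p1 p2 side_def by (simp add: p_def)
  then have "(\<Sum>m<r. F1 (m + 2) + F2 m) < (\<Sum>m<r. F1 (m + 1) + F2 (m + 1))"
    using out r(1) by (intro sum_strict_mono_ex1) auto
  then show False
    using sum_periodic_shift[of F1 r, OF per(1)] sum_periodic_shift[of F2 r, OF per(2)]
    by (simp only: sum.distrib)
qed

text \<open>Up to a shift by a multiple of \<open>n\<close>, a periodic point is the image under
  \<open>far\<close> of another point of its orbit.\<close>

lemma level_end_periodic:
  assumes "far_periodic a"
  shows "level_end a = a"
proof -
  obtain r w where r: "0 < r" "(far ^^ r) a = a + w * n" using assms by (auto simp: far_periodic_def)
  have "far_periodic ((far ^^ m) a)" for m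
    by (induction m) (simp_all add: assms far_periodic_far)
  then have "level_end (far ((far ^^ (r - 1)) a)) = far ((far ^^ (r - 1)) a)"
    by (rule level_end_far_periodic)
  moreover have "far ((far ^^ (r - 1)) a) = a + w * n"
    using r by (metis Suc_diff_1 comp_apply funpow.simps(2))
  ultimately show ?thesis by (simp add: level_end_shift)
qed

text \<open>As \<open>a\<close> and \<open>far a\<close> end their levels, the right-hand side of
  \<open>outer_sum_le\<close> is zero, so the outer arc from \<open>far (far a) + 1\<close> to
  \<open>a + n\<close> has no edges.\<close>

lemma far_far_periodic:
  assumes "far_periodic a"
  shows "far (far a) = a + n - 1"
proof (rule ccontr)
  assume "far (far a) \<noteq> a + n - 1"
  then have "far (far a) + 1 < a + n" using far_far_less[of a] by simp
  then have "0 < sum len {far (far a) + 1..<a + n}"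
    by (intro sum_pos) (auto simp: len_pos)
  then show False
    using outer_sum_le(1)[of a] level_end_periodic[OF assms] level_end_far_periodic[OF assms] by simp
qed

text \<open>By \<open>far_far_periodic\<close>, \<open>a - 1\<close> is periodic along with
  \<open>a\<close>; descending from one periodic point and shifting by multiples of \<open>n\<close>
  reaches every index.\<close>

lemma far_periodic_all: "far_periodic z"
proof -
  obtain a where a: "far_periodic a" using ex_far_periodic by blast
  have down: "far_periodic (a - int t)" for t
  proof (induction t)
    case (Suc t)
    then have "far_periodic (far (far (a - int t)) + (- 1) * n)"
      by (intro far_periodic_shift far_periodic_far)
    then show ?case using far_far_periodic[OF Suc] by (simp add: algebra_simps)
  qed (simp add: a)
  define s where "s = max 0 (z - a)"
  have "s * 1 \<le> s * n" using three_le by (intro mult_left_mono) (auto simp: s_def)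
  then have "z - s * n \<le> a" by (simp add: s_def)
  then have "a - int (nat (a - (z - s * n))) = z - s * n" by simp
  then have "far_periodic (z - s * n + s * n)" using down far_periodic_shift by metis
  then show ?thesis by simp
qed

text \<open>Every index now ends its level, so \<open>far\<close> increases at each step; over one
  period it gains exactly \<open>n\<close>, hence one per step.\<close>

lemma far_Suc: "far (b + 1) = far b + 1"
proof -
  have step: "far c + 1 \<le> far (c + 1)" for c
    using far_after_level_end[of c] level_end_periodic[OF far_periodic_all[of c]] by simp
  have "far c + int m \<le> far (c + int m)" for c m
  proof (induction m)
    case (Suc m)
    then show ?case using step[of "c + int m"] by (simp add: algebra_simps)
  qed simp
  from this[of "b + 1" "nat (n - 1)"] have "far (b + 1) + (n - 1) \<le> far (b + n)"
    using three_le by simp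
  then show ?thesis using step[of b] far_shift[of b 1] by simp
qed

lemma far_eq: "far b = b + far 0"
proof (induction b rule: int_induct[of _ 0])
  case (step2 i)
  then show ?case using far_Suc[of "i - 1"] by simp
qed (simp_all add: far_Suc)

lemma period_eq: "n = 2 * far 0 + 1"
  using far_far_periodic[OF far_periodic_all[of 0]] far_eq[of "far 0"] by simp

lemma card_D_eq: "int (card D) = far 0"
  using card_D period_eq far_le[of 0] by simp

section \<open>Distances from one vertex\<close>

lemma opposite_le: "d b (b + far 0 + 1) \<le> d b (b + far 0)"
  using far_barrier_right[of b] by (simp add: far_eq[of b])

text \<open>The left barrier read at the other end: the chord from \<open>b + far 0\<close> leads
  round to \<open>b + n\<close>, the same vertex as \<open>b\<close>. With
  \<open>opposite_le\<close>, \<open>v b\<close> lies on the bisector of the opposite edge.\<close>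

lemma opposite_ge: "d b (b + far 0) \<le> d b (b + far 0 + 1)"
proof -
  let ?i = "b + far 0"
  have "d ?i (far ?i + 1) \<le> d (?i + 1) (far ?i + 1)"
    by (rule far_barrier_left) (simp add: far_Suc)
  moreover have "far ?i + 1 = b + n" by (simp add: far_eq[of ?i] period_eq)
  ultimately show ?thesis by (simp add: periodic dist_commute)
qed

text \<open>The bisector of edge \<open>b + s\<close> passes through the opposite vertex
  \<open>v (b + s - far 0)\<close>, and \<open>v b\<close> comes after that vertex, on the side of
  \<open>v (b + s)\<close>.\<close>

lemma dist_forward_step:
  assumes "0 \<le> s" "s < far 0"
  shows "d b (b + s) < d b (b + s + 1)"
proof -
  let ?g = "b + s"
  have "proj ?g (v (?g - far 0 + n)) \<le> len ?g / 2"
    using opposite_ge[of "?g - far 0"] dist_le_iff_proj[of "v (?g - far 0)" ?g] by (simp add: periodic)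
  then have "proj ?g (v (b + n)) < len ?g / 2"
    using assms period_eq by (intro bisector[of ?g "?g - far 0 + n" "b + n"]) auto
  then show ?thesis using dist_ge_iff_proj[of "v b" ?g] by (simp add: periodic)
qed

lemma dist_backward_step:
  assumes "0 \<le> s" "s < far 0"
  shows "d b (b - s) < d b (b - s - 1)"
proof (rule ccontr)
  let ?g = "b - s - 1"
  assume *: "\<not> ?thesis"
  have "proj ?g (v b) \<le> len ?g / 2"
    using * dist_le_iff_proj[of "v b" ?g] by simp
  then have "proj ?g (v (?g - far 0 + n)) < len ?g / 2"
    using assms period_eq by (intro bisector[of ?g b "?g - far 0 + n"]) auto
  then show False
    using opposite_le[of "?g - far 0"] dist_ge_iff_proj[of "v (?g - far 0)" ?g] by (simp add: periodic)
qed

lemma strict_mono_from_steps: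
  fixes f :: "int \<Rightarrow> real"
  assumes "\<And>s. 0 \<le> s \<Longrightarrow> s < k \<Longrightarrow> f s < f (s + 1)"
  shows "s < t \<Longrightarrow> 0 \<le> s \<Longrightarrow> t \<le> k \<Longrightarrow> f s < f t"
proof (induction t rule: int_gr_induct)
  case (step t)
  then show ?case using assms[of t] by simp
qed (use assms in auto)

lemma vertex_inj:
  assumes "v i = v j" "\<bar>i - j\<bar> < n"
  shows "i = j"
  using vertex_neq[of i j] vertex_neq[of j i] assms by (cases i j rule: linorder_cases) auto

text \<open>In both directions the distances from \<open>v b\<close> increase strictly over
  \<open>far 0 = card D\<close> steps, so each run takes every value in \<open>D\<close> once;
  together the two runs meet every other vertex.\<close>

lemma card_at_distance:
  assumes "\<delta> \<in> D"
  shows "card {y \<in> range v. dist (v b) y = \<delta>} = 2"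
proof -
  let ?K = "far 0"
  have unique: "\<exists>s. 1 \<le> s \<and> s \<le> ?K \<and> f s = \<delta> \<and>
      (\<forall>s'. 1 \<le> s' \<longrightarrow> s' \<le> ?K \<longrightarrow> f s' = \<delta> \<longrightarrow> s' = s)"
    if f: "\<And>s. 0 \<le> s \<Longrightarrow> s < ?K \<Longrightarrow> f s < f (s + 1)" and "f 0 = 0"
      and "\<And>s. f s = d b (g s)" for f :: "int \<Rightarrow> real" and g
  proof -
    note mono = strict_mono_from_steps[of ?K f, OF f]
    have inj: "inj_on f {1..?K}"
    proof (rule linorder_inj_onI)
      fix s t assume "s < t" "s \<in> {1..?K}" "t \<in> {1..?K}"
      then show "f s \<noteq> f t" using mono[of s t] by simp
    qed auto
    have "f ` {1..?K} \<subseteq> D"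
    proof
      fix x assume "x \<in> f ` {1..?K}"
      then obtain s where "s \<in> {1..?K}" "x = f s" by auto
      then have "0 < d b (g s)" using mono[of 0 s] that(2,3) by simp
      then show "x \<in> D" using dist_in_D_if_less[of 0] \<open>x = f s\<close> that(3) by simp
    qed
    moreover have "card (f ` {1..?K}) = card D"
      using card_D_eq less_far[of 0] by (simp add: card_image[OF inj])
    ultimately have "f ` {1..?K} = D" using finite_D by (simp add: card_subset_eq)
    then obtain s where "s \<in> {1..?K}" "f s = \<delta>" using assms by auto
    then show ?thesis using inj by (intro exI[of _ s]) (auto simp: inj_on_def)
  qed
  have "\<exists>s. 1 \<le> s \<and> s \<le> ?K \<and> d b (b + s) = \<delta> \<and>
      (\<forall>s'. 1 \<le> s' \<longrightarrow> s' \<le> ?K \<longrightarrow> d b (b + s') = \<delta> \<longrightarrow> s' = s)"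
    by (rule unique[of "\<lambda>s. d b (b + s)" "\<lambda>s. b + s"])
      (simp_all add: dist_forward_step add.assoc[symmetric])
  then obtain s where s: "1 \<le> s" "s \<le> ?K" "d b (b + s) = \<delta>"
    and s_unique: "\<And>s'. 1 \<le> s' \<Longrightarrow> s' \<le> ?K \<Longrightarrow> d b (b + s') = \<delta> \<Longrightarrow> s' = s" by blast
  have "\<exists>t. 1 \<le> t \<and> t \<le> ?K \<and> d b (b - t) = \<delta> \<and>
      (\<forall>t'. 1 \<le> t' \<longrightarrow> t' \<le> ?K \<longrightarrow> d b (b - t') = \<delta> \<longrightarrow> t' = t)"
    by (rule unique[of "\<lambda>s. d b (b - s)" "\<lambda>s. b - s"])
      (simp_all add: dist_backward_step diff_diff_eq[symmetric])
  then obtain t where t: "1 \<le> t" "t \<le> ?K" "d b (b - t) = \<delta>"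
    and t_unique: "\<And>t'. 1 \<le> t' \<Longrightarrow> t' \<le> ?K \<Longrightarrow> d b (b - t') = \<delta> \<Longrightarrow> t' = t" by blast
  have "0 < \<delta>"
    using s vertex_neq[of b "b + s"] period_eq by auto
  have "{y \<in> range v. dist (v b) y = \<delta>} = {v (b + s), v (b - t)}"
  proof (intro equalityI subsetI)
    fix y assume "y \<in> {y \<in> range v. dist (v b) y = \<delta>}"
    then obtain j where j: "y = v j" "d b j = \<delta>" by auto
    \<comment> \<open>The residue of \<open>j - b\<close> modulo \<open>n\<close> lying between
      \<open>- far 0\<close> and \<open>far 0\<close>; its sign tells to which run
      \<open>v j\<close> belongs.\<close>
    define m where "m = (j - b + ?K) mod n - ?K"
    have m: "- ?K \<le> m" "m \<le> ?K"
      using three_le period_eq pos_mod_bound[of n "j - b + ?K"] pos_mod_sign[of n "j - b + ?K"]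
      by (auto simp: m_def)
    have "b + m + ((j - b + ?K) div n) * n = j"
      using div_mult_mod_eq[of "j - b + ?K" n] unfolding m_def by linarith
    then have vm: "v (b + m) = v j" using periodic_mult by metis
    have "m \<noteq> 0" using vm j \<open>0 < \<delta>\<close> by auto
    then consider "1 \<le> m" | "1 \<le> - m" by linarith
    then show "y \<in> {v (b + s), v (b - t)}"
    proof cases
      case 1
      then show ?thesis using s_unique[of m] m vm j by auto
    next
      case 2
      then show ?thesis using t_unique[of "- m"] m vm j by auto
    qed
  qed (use s t in auto)
  moreover have "v (b + s) \<noteq> v (b - t)"
    using vertex_inj[of "b + s" "b - t"] s t period_eq by auto
  ultimately show ?thesis by simp
qed

end

section \<open>Enumerating points in convex position\<close>

lemma ex_strict_mono_enum:
  fixes f :: "'a \<Rightarrow> real"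
  assumes "finite S" "inj_on f S"
  shows "\<exists>w. bij_betw w {..<card S} S \<and> (\<forall>i j. i < j \<longrightarrow> j < card S \<longrightarrow> f (w i) < f (w j))"
proof -
  let ?xs = "sorted_list_of_set (f ` S)"
  have len: "length ?xs = card S" using assms by (simp add: card_image)
  have bij: "bij_betw ((!) ?xs) {..<card S} (f ` S)"
    using bij_betw_nth[of ?xs "{..<card S}" "f ` S"] assms len by simp
  have "bij_betw (inv_into S f \<circ> (!) ?xs) {..<card S} S"
    by (rule bij_betw_trans[OF bij]) (simp add: assms(2) bij_betw_inv_into inj_on_imp_bij_betw)
  moreover have "f (inv_into S f (?xs ! i)) = ?xs ! i" if "i < card S" for i
    using bij that by (intro f_inv_into_f) (auto simp: bij_betw_def)
  moreover have "?xs ! i < ?xs ! j" if "i < j" "j < card S" for i j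
    using that len sorted_wrt_nth_less[OF strict_sorted_list_of_set[of "f ` S"], of i j] by simp
  ultimately show ?thesis
    by (intro exI[of _ "inv_into S f \<circ> (!) ?xs"]) simp
qed

lemma det2_polar:
  "det2 (complex_of_real r * cis s) (complex_of_real r' * cis s') = r * r' * sin (s' - s)"
  by (simp add: det2_def sin_diff algebra_simps)

lemma sin_pos_imp_pos:
  assumes "0 < sin t" "- pi < t"
  shows "0 < t"
proof (rule ccontr)
  assume "\<not> 0 < t"
  then have "0 \<le> sin (- t)" using assms by (intro sin_ge_zero) auto
  then show False using assms by simp
qed

text \<open>The points are listed by increasing angle as seen from one of them; the separating line
  through that point makes the angles comparable.\<close>

lemma ex_star_enum:
  fixes Y :: "complex set"
  assumes "finite Y" "3 \<le> card Y" and conv: "\<forall>x\<in>Y. x \<notin> convex hull (Y - {x})"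
  shows "\<exists>P \<phi>. bij_betw P {..<card Y} Y \<and>
    (\<forall>k. 0 < k \<longrightarrow> k < card Y \<longrightarrow> P k - P 0 = complex_of_real (cmod (P k - P 0)) * cis (\<phi> k)) \<and>
    (\<forall>i j. 0 < i \<longrightarrow> i < j \<longrightarrow> j < card Y \<longrightarrow> \<phi> i < \<phi> j \<and> \<phi> j < \<phi> i + pi)"
proof -
  obtain x0 where x0: "x0 \<in> Y" using assms(2) by fastforce
  define S where "S = Y - {x0}"
  have fin: "finite S" and card_S: "card Y = Suc (card S)"
    using assms(1) card.remove[OF assms(1) x0] by (simp_all add: S_def)
  have "closed (convex hull S)" using fin by (simp add: compact_imp_closed finite_imp_compact_convex_hull)
  then obtain a r where ar: "a \<bullet> x0 < r" "\<And>x. x \<in> convex hull S \<Longrightarrow> r < a \<bullet> x"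
    using separating_hyperplane_closed_point[of "convex hull S" x0] bspec[OF conv x0]
    by (auto simp: S_def)
  have pos: "0 < a \<bullet> (x - x0)" if "x \<in> S" for x
    using ar(1) ar(2)[of x] hull_inc[OF that, of convex] by (simp add: inner_diff_right)
  have "S \<noteq> {}" using card_S assms(2) by auto
  then have a0: "a \<noteq> 0" using pos by auto
  \<comment> \<open>Angles are measured from the normal \<open>a\<close>: the other points lie
    within pi/2 of it, away from the branch cut of \<open>Arg\<close>.\<close>
  define \<psi> where "\<psi> x = Arg a + Arg ((x - x0) / a)" for x
  have Re_pos: "0 < Re ((x - x0) / a)" if "x \<in> S" for x
  proof -
    have "Re ((x - x0) / a) = a \<bullet> (x - x0) / (cmod a)\<^sup>2"
      by (simp add: Re_divide inner_complex_def cmod_power2 algebra_simps)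
    then show ?thesis using pos[OF that] a0 by simp
  qed
  have bound: "\<bar>\<psi> x - Arg a\<bar> < pi / 2" if "x \<in> S" for x
    using Re_pos[OF that] Arg_Re_pos[of "(x - x0) / a"] by (simp add: \<psi>_def)
  have polar: "x - x0 = complex_of_real (cmod (x - x0)) * cis (\<psi> x)" for x
  proof -
    have "x - x0 = a * ((x - x0) / a)" using a0 by simp
    also have "\<dots> = rcis (cmod a) (Arg a) * rcis (cmod ((x - x0) / a)) (Arg ((x - x0) / a))"
      by (simp only: rcis_cmod_Arg)
    also have "\<dots> = rcis (cmod (x - x0)) (\<psi> x)"
      using a0 by (simp add: rcis_mult \<psi>_def norm_divide)
    finally show ?thesis by (simp add: rcis_def)
  qed
  \<comment> \<open>Of two points on one ray from \<open>x0\<close>, the nearer lies on the segment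
    from \<open>x0\<close> to the other.\<close>
  have no_ray: False
    if "x \<in> S" "y \<in> S" "x \<noteq> y" "\<psi> x = \<psi> y" "cmod (x - x0) \<le> cmod (y - x0)" for x y
  proof -
    define t where "t = cmod (x - x0) / cmod (y - x0)"
    have "y \<noteq> x0" using that by (auto simp: S_def)
    then have t: "0 \<le> t" "t \<le> 1" and "cmod (x - x0) = t * cmod (y - x0)"
      using that by (auto simp: t_def)
    then have "x - x0 = t *\<^sub>R (y - x0)"
      using polar[of x] polar[of y] that(4) by (simp add: scaleR_conv_of_real)
    then have "x = (1 - t) *\<^sub>R x0 + t *\<^sub>R y" by (simp add: algebra_simps)
    moreover have "x0 \<in> convex hull (Y - {x})" "y \<in> convex hull (Y - {x})"
      using that x0 by (auto simp: S_def intro!: hull_inc)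
    ultimately have "x \<in> convex hull (Y - {x})"
      using convexD_alt[OF convex_convex_hull] t by metis
    then show False using conv that by (simp add: S_def)
  qed
  have inj: "inj_on \<psi> S"
    using no_ray by (metis inj_onI linorder_le_cases)
  obtain w where w: "bij_betw w {..<card S} S"
    and w_mono: "\<And>i j. i < j \<Longrightarrow> j < card S \<Longrightarrow> \<psi> (w i) < \<psi> (w j)"
    using ex_strict_mono_enum[OF fin inj] by blast
  have wS: "w i \<in> S" if "i < card S" for i using w that by (auto simp: bij_betw_def)
  define P where "P k = (case k of 0 \<Rightarrow> x0 | Suc i \<Rightarrow> w i)" for k
  have "bij_betw P {..<card Y} Y"
  proof -
    have "{..<card Y} = insert 0 (Suc ` {..<card S})"
      by (simp add: card_S lessThan_Suc_eq_insert_0)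
    moreover have "P ` (Suc ` {..<card S}) = S"
      using w by (simp add: image_image P_def bij_betw_def)
    ultimately have "P ` {..<card Y} = Y"
      using x0 by (auto simp: P_def S_def)
    then show ?thesis by (simp add: bij_betw_def eq_card_imp_inj_on)
  qed
  moreover have "\<psi> (P i) < \<psi> (P j) \<and> \<psi> (P j) < \<psi> (P i) + pi" if "0 < i" "i < j" "j < card Y" for i j
  proof -
    define i' j' where "i' = i - 1" and "j' = j - 1"
    then have ij: "i = Suc i'" "j = Suc j'" using that by auto
    then have lt: "i' < j'" "j' < card S" using that card_S by auto
    then have "i' < card S" by simp
    moreover have "P i = w i'" "P j = w j'" by (simp_all add: P_def ij)
    moreover have "\<bar>\<psi> (w i') - Arg a\<bar> < pi / 2" "\<bar>\<psi> (w j') - Arg a\<bar> < pi / 2"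
      using bound[OF wS[of i']] bound[OF wS[of j']] lt by simp_all
    then have "\<psi> (w j') < \<psi> (w i') + pi" by linarith
    ultimately show ?thesis using w_mono[OF lt] by simp
  qed
  moreover have "P k - P 0 = complex_of_real (cmod (P k - P 0)) * cis (\<psi> (P k))" for k
  proof -
    have "P 0 = x0" by (simp add: P_def)
    then show ?thesis using polar[of "P k"] by (simp only:)
  qed
  ultimately show ?thesis
    by (intro exI[of _ P] exI[of _ "\<lambda>k. \<psi> (P k)"]) blast
qed

text \<open>In the enumeration around one point, convex position orients the remaining triples and
  edge angles are fixed for one round; vertices and angles are then continued to all
  integers.\<close>

lemma ex_convex_polygon:
  fixes Y :: "complex set"
  assumes "finite Y" "3 \<le> card Y" and conv: "\<forall>x\<in>Y. x \<notin> convex hull (Y - {x})"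
  shows "\<exists>v \<theta>. convex_polygon v \<theta> (int (card Y)) \<and> range v = Y"
proof -
  define N where "N = card Y"
  have N: "3 \<le> N" using assms(2) by (simp add: N_def)
  obtain P \<phi> where P: "bij_betw P {..<N} Y \<and>
    (\<forall>k. 0 < k \<longrightarrow> k < N \<longrightarrow> P k - P 0 = complex_of_real (cmod (P k - P 0)) * cis (\<phi> k)) \<and>
    (\<forall>i j. 0 < i \<longrightarrow> i < j \<longrightarrow> j < N \<longrightarrow> \<phi> i < \<phi> j \<and> \<phi> j < \<phi> i + pi)"
    using ex_star_enum[OF assms] unfolding N_def by (elim exE)
  have bij: "bij_betw P {..<N} Y" using P by (rule conjunct1)
  have polar: "P k - P 0 = complex_of_real (cmod (P k - P 0)) * cis (\<phi> k)" if "0 < k" "k < N" for k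
    using P[THEN conjunct2, THEN conjunct1, rule_format, OF that] .
  note \<phi> = P[THEN conjunct2, THEN conjunct2, rule_format]
  have \<phi>_less: "\<phi> i < \<phi> j" and \<phi>_diff: "\<phi> j < \<phi> i + pi" if "0 < i" "i < j" "j < N" for i j
    using \<phi>[OF that] by auto
  have neq: "P i \<noteq> P j" if "i \<noteq> j" "i < N" "j < N" for i j
    using bij that by (auto simp: bij_betw_def inj_on_def)
  have in_Y: "P i \<in> Y" if "i < N" for i using bij that by (auto simp: bij_betw_def)
  have star: "0 < det2 (P i - P 0) (P j - P 0)" if "0 < i" "i < j" "j < N" for i j
  proof -
    have i: "0 < i" "i < N" and j: "0 < j" "j < N" using that by auto
    have "det2 (P i - P 0) (P j - P 0) = cmod (P i - P 0) * cmod (P j - P 0) * sin (\<phi> j - \<phi> i)"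
      by (subst polar[OF i], subst polar[OF j]) (rule det2_polar)
    moreover have "0 < sin (\<phi> j - \<phi> i)"
      using \<phi>_less[OF that] \<phi>_diff[OF that] by (intro sin_gt_zero) auto
    ultimately show ?thesis using neq[of i 0] neq[of j 0] i j N by simp
  qed
  \<comment> \<open>For \<open>i > 0\<close>, a clockwise or degenerate triple would put
    \<open>P j\<close> into the triangle with corners \<open>P 0\<close>, \<open>P i\<close>,
    \<open>P k\<close>.\<close>
  have orient: "0 < det2 (P j - P i) (P k - P i)" if ijk: "i < j" "j < k" "k < N" for i j k
  proof (cases "i = 0")
    case True
    then show ?thesis using star ijk by simp
  next
    case False
    define A B C where "A = P i - P 0" and "B = P j - P 0" and "C = P k - P 0"
    have c: "0 < det2 A B" "0 < det2 B C" "0 < det2 A C"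
      using star[of i j] star[of j k] star[of i k] False ijk by (auto simp: A_def B_def C_def)
    have eq: "det2 (P j - P i) (P k - P i) = det2 A B + det2 B C - det2 A C"
      by (simp add: det2_def A_def B_def C_def algebra_simps)
    show ?thesis
    proof (rule ccontr)
      assume "\<not> ?thesis"
      then have le: "det2 A B + det2 B C \<le> det2 A C" using eq by simp
      \<comment> \<open>Coefficients of \<open>B\<close> in the basis \<open>A\<close>,
        \<open>C\<close> by Cramer's rule.\<close>
      define s t where "s = det2 B C / det2 A C" and "t = det2 A B / det2 A C"
      have st: "0 \<le> s" "0 \<le> t" "s + t \<le> 1"
        using c le by (simp_all add: s_def t_def add_divide_distrib[symmetric])
      have "B = s *\<^sub>R A + t *\<^sub>R C"
      proof -
        have "det2 A C *\<^sub>R B = det2 B C *\<^sub>R A + det2 A B *\<^sub>R C"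
          by (simp add: det2_def complex_eq_iff algebra_simps)
        then have "(1 / det2 A C) *\<^sub>R det2 A C *\<^sub>R B = (1 / det2 A C) *\<^sub>R (det2 B C *\<^sub>R A + det2 A B *\<^sub>R C)"
          by (rule arg_cong)
        then show ?thesis using c by (simp add: s_def t_def scaleR_add_right)
      qed
      then have "P j = P 0 + s *\<^sub>R (P i - P 0) + t *\<^sub>R (P k - P 0)"
        unfolding A_def B_def C_def by (simp add: algebra_simps)
      then have "P j \<in> convex hull {P 0, P i, P k}"
        unfolding convex_hull_3_alt using st by blast
      moreover have "{P 0, P i, P k} \<subseteq> Y - {P j}"
        using ijk N neq in_Y by auto
      ultimately have "P j \<in> convex hull (Y - {P j})"
        using hull_mono by blast
      then show False using conv in_Y ijk by simp
    qed
  qed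
  \<comment> \<open>Angle of the edge leaving \<open>P k\<close>. The last edge runs back to
    \<open>P 0\<close>, hence the added pi; for the middle edges the \<open>Arg\<close> term is the
    turn from the ray through \<open>P k\<close>, between 0 and pi.\<close>
  define \<tau> where "\<tau> k = (if k = 0 then \<phi> 1 else if k = N - 1 then \<phi> (N - 1) + pi
    else \<phi> k + Arg ((P (k + 1) - P k) / (P k - P 0)))" for k
  have mid: "P (k + 1) - P k = complex_of_real (cmod (P (k + 1) - P k)) * cis (\<tau> k)"
    "\<phi> (k + 1) < \<tau> k" "\<tau> k < \<phi> k + pi" if k: "0 < k" "k + 1 < N" for k
  proof -
    define y z where "y = P k - P 0" and "z = (P (k + 1) - P k) / y"
    have y: "y \<noteq> 0" using neq[of k 0] k by (simp add: y_def)
    have "k \<noteq> N - 1" using k by auto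
    then have \<tau>: "\<tau> k = \<phi> k + Arg z" using k by (simp add: \<tau>_def z_def y_def)
    have det: "det2 (P k - P 0) (P (k + 1) - P k) = det2 (P k - P 0) (P (k + 1) - P 0)"
      by (simp add: det2_def algebra_simps)
    have "Im z = det2 y (P (k + 1) - P k) / (cmod y)\<^sup>2"
      unfolding z_def Im_divide by (simp add: det2_def cmod_power2 algebra_simps)
    then have "0 < Im z" using star[of k "k + 1"] det k y by (simp add: y_def)
    then have Arg_z: "0 < Arg z" "Arg z < pi" using Arg_lt_pi by auto
    then show up: "\<tau> k < \<phi> k + pi" using \<tau> by simp
    have "P (k + 1) - P k = y * z" using y by (simp add: z_def)
    also have "y = rcis (cmod y) (\<phi> k)" using polar[of k] k by (simp add: y_def rcis_def)
    also have "z = rcis (cmod z) (Arg z)" by (simp add: rcis_cmod_Arg)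
    also have "rcis (cmod y) (\<phi> k) * rcis (cmod z) (Arg z) = rcis (cmod (y * z)) (\<tau> k)"
      by (simp add: rcis_mult \<tau> norm_mult)
    also have "y * z = P (k + 1) - P k" using y by (simp add: z_def)
    finally show e: "P (k + 1) - P k = complex_of_real (cmod (P (k + 1) - P k)) * cis (\<tau> k)"
      by (simp only: rcis_def)
    have k1: "0 < k + 1" "k + 1 < N" using k by auto
    have "0 < det2 (P (k + 1) - P 0) (P (k + 1) - P k)"
      using star[of k "k + 1"] k by (simp add: det2_def algebra_simps)
    also have "\<dots> = cmod (P (k + 1) - P 0) * cmod (P (k + 1) - P k) * sin (\<tau> k - \<phi> (k + 1))"
      by (subst polar[OF k1], subst e) (rule det2_polar)
    finally have "0 < sin (\<tau> k - \<phi> (k + 1))"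
      by (metis less_le_not_le mult_nonneg_nonneg mult_nonneg_nonpos norm_ge_zero linorder_le_cases)
    moreover have "\<phi> (k + 1) < \<phi> k + pi" using \<phi>_diff[of k "k + 1"] k by simp
    then have "- pi < \<tau> k - \<phi> (k + 1)" using \<tau> Arg_z by linarith
    ultimately have "0 < \<tau> k - \<phi> (k + 1)" by (rule sin_pos_imp_pos)
    then show "\<phi> (k + 1) < \<tau> k" by simp
  qed
  have edge: "P (Suc k mod N) - P k = complex_of_real (cmod (P (Suc k mod N) - P k)) * cis (\<tau> k)"
    if "k < N" for k
  proof -
    have "k = 0 \<or> k = N - 1 \<or> 0 < k \<and> k + 1 < N" using that by auto
    then consider "k = 0" | "k = N - 1" | "0 < k" "k + 1 < N" by blast
    then show ?thesis
    proof cases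
      case 1
      then show ?thesis using polar[of 1] N by (simp add: \<tau>_def)
    next
      case 2
      then have "Suc k mod N = 0" "\<tau> k = \<phi> k + pi" using N by (simp_all add: \<tau>_def)
      moreover have "P 0 - P k = - (complex_of_real (cmod (P k - P 0)) * cis (\<phi> k))"
      proof -
        have "0 < k" "k < N" using 2 N by auto
        then show ?thesis using polar[of k] by (metis minus_diff_eq)
      qed
      moreover have "cis (\<phi> k + pi) = - cis (\<phi> k)" by (simp add: complex_eq_iff)
      ultimately show ?thesis by (metis mult_minus_right norm_minus_commute)
    next
      case 3
      then show ?thesis using mid(1)[of k] by simp
    qed
  qed
  have \<tau>_step: "\<tau> k < \<tau> (k + 1)" if "k + 1 < N" for k
  proof (cases "k = 0")
    case True
    then show ?thesis using mid(2)[of 1] \<phi>_less[of 1 2] N by (simp add: \<tau>_def numeral_2_eq_2)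
  next
    case False
    show ?thesis
    proof (cases "k + 1 = N - 1")
      case True
      then have "\<tau> (k + 1) = \<phi> (k + 1) + pi" using N by (simp add: \<tau>_def)
      then show ?thesis using mid(3)[of k] \<phi>_less[of k "k + 1"] False that by simp
    next
      case k: False
      then have k1: "0 < k" "k + 1 < N" "0 < k + 1" "k + 1 + 1 < N" using False that by auto
      \<comment> \<open>Orientation makes the sine of the turn positive, and the bounds in
        \<open>mid\<close> keep the turn above \<open>- pi\<close>.\<close>
      have "0 < det2 (P (k + 1) - P k) (P (k + 1 + 1) - P k)" using k1 by (intro orient) auto
      also have "\<dots> = det2 (P (k + 1) - P k) (P (k + 1 + 1) - P (k + 1))"
        by (simp add: det2_def algebra_simps)
      also have "\<dots> = cmod (P (k + 1) - P k) * cmod (P (k + 1 + 1) - P (k + 1)) * sin (\<tau> (k + 1) - \<tau> k)"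
        by (subst mid(1)[OF k1(1,2)], subst mid(1)[OF k1(3,4)]) (rule det2_polar)
      finally have "0 < sin (\<tau> (k + 1) - \<tau> k)"
        by (metis less_le_not_le mult_nonneg_nonneg mult_nonneg_nonpos norm_ge_zero linorder_le_cases)
      moreover have "\<phi> k < \<phi> (k + 1 + 1)" using \<phi>_less[of k "k + 1 + 1"] k1 by simp
      then have "- pi < \<tau> (k + 1) - \<tau> k" using mid(2)[OF k1(3,4)] mid(3)[OF k1(1,2)] by linarith
      ultimately have "0 < \<tau> (k + 1) - \<tau> k" by (rule sin_pos_imp_pos)
      then show ?thesis by simp
    qed
  qed
  have \<tau>_wrap: "\<tau> (N - 1) < \<tau> 0 + 2 * pi"
  proof -
    have "1 < N - 1" "N - 1 < N" using N by linarith+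
    then have "\<phi> (N - 1) < \<phi> 1 + pi" using \<phi>_diff[of 1 "N - 1"] by simp
    then show ?thesis using N by (simp add: \<tau>_def)
  qed
  define n where "n = int N"
  \<comment> \<open>The quotient by \<open>n\<close> counts completed rounds, each adding a full
    turn.\<close>
  define v \<theta> where "v i = P (nat (i mod n))" and "\<theta> i = \<tau> (nat (i mod n)) + 2 * pi * (i div n)" for i
  have v_int: "v (q * n + int m) = P m" and \<theta>_int: "\<theta> (q * n + int m) = \<tau> m + 2 * pi * q"
    if "m < N" for q m
    using that N by (simp_all add: v_def \<theta>_def n_def)
  have repr: "\<exists>q m. i = q * n + int m \<and> m < N" for i
    using N by (intro exI[of _ "i div n"] exI[of _ "nat (i mod n)"]) (simp add: n_def nat_less_iff)
  have v_per: "v (i + n) = v i" and \<theta>_per: "\<theta> (i + n) = \<theta> i + 2 * pi" for i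
    using N by (simp_all add: v_def \<theta>_def n_def algebra_simps)
  have v_shift: "v (i + q * n) = v i" for i q
    by (simp add: v_def)
  have next_vertex: "v (q * n + int m + 1) = P (Suc m mod N)" if "m < N" for q m
  proof (cases "Suc m < N")
    case True
    then show ?thesis using v_int[of "Suc m" q] by (simp add: algebra_simps)
  next
    case False
    then have "N = Suc m" using that by simp
    then have "q * n + int m + 1 = (q + 1) * n + int 0" "Suc m mod N = 0"
      by (simp_all add: n_def algebra_simps)
    then show ?thesis using v_int[of 0 "q + 1"] N by simp
  qed
  have \<theta>_step: "\<theta> i < \<theta> (i + 1)" for i
  proof -
    obtain q m where i: "i = q * n + int m" "m < N" using repr by blast
    show ?thesis
    proof (cases "Suc m < N")
      case True
      then have "\<theta> (i + 1) = \<tau> (m + 1) + 2 * pi * q"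
        using \<theta>_int[of "Suc m" q] i by (simp add: algebra_simps)
      then show ?thesis using \<tau>_step[of m] True i \<theta>_int[of m q] by simp
    next
      case False
      then have m: "m = N - 1" and "i + 1 = (q + 1) * n + int 0"
        using i by (simp_all add: n_def algebra_simps)
      then have "\<theta> (i + 1) = \<tau> 0 + 2 * pi * (q + 1)" using \<theta>_int[of 0 "q + 1"] N by simp
      moreover have "\<theta> i = \<tau> (N - 1) + 2 * pi * q" using \<theta>_int[OF i(2), of q] by (simp only: i(1) m)
      ultimately show ?thesis using \<tau>_wrap by (simp add: distrib_left)
    qed
  qed
  have "convex_polygon v \<theta> n"
  proof
    show "3 \<le> n" using N by (simp add: n_def)
    show "v (i + n) = v i" "\<theta> (i + n) = \<theta> i + 2 * pi" for i by (rule v_per, rule \<theta>_per)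
    show "\<theta> i < \<theta> j" if "i < j" for i j
      using that
    proof (induction j rule: int_gr_induct)
      case (step j)
      then show ?case using \<theta>_step[of j] by simp
    qed (rule \<theta>_step)
    show "v (i + 1) - v i = complex_of_real (cmod (v (i + 1) - v i)) * cis (\<theta> i)" for i
    proof -
      obtain q m where i: "i = q * n + int m" "m < N" using repr by blast
      have "cis (\<theta> i) = cis (\<tau> m)"
        using \<theta>_int[OF i(2), of q] i(1) by (simp add: cis_mult[symmetric] cis_multiple_2pi)
      then show ?thesis
        using edge[OF i(2)] next_vertex[OF i(2), of q] v_int[OF i(2), of q] i(1) by simp
    qed
    show "0 < det2 (v j - v i) (v k - v i)" if ijk: "i < j" "j < k" "k < i + n" for i j k
    proof -
      obtain q m where i: "i = q * n + int m" "m < N" using repr by blast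
      define j' k' where "j' = nat (j - q * n)" and "k' = nat (k - q * n)"
      have j: "j = q * n + int j'" and k: "k = q * n + int k'" and lt: "m < j'" "j' < k'" "k' < m + N"
        using ijk i by (auto simp: j'_def k'_def n_def)
      have wrap: "v (q * n + int (l + N)) = P l" if "l < N" for l
        using v_int[OF that, of "q + 1"] by (simp add: n_def algebra_simps)
      have cyc: "det2 (b - a) (c - a) = det2 (c - b) (a - b)" for a b c
        by (simp add: det2_def algebra_simps)
      \<comment> \<open>Neither, one or both of the later indices have passed the end of the period
        of \<open>i\<close>; the cyclic rotation \<open>cyc\<close> restores increasing
        order.\<close>
      consider "k' < N" | "j' < N" "N \<le> k'" | "N \<le> j'" by linarith
      then show ?thesis
      proof cases
        case 1
        then show ?thesis using orient[of m j' k'] v_int lt i j k by simp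
      next
        case 2
        then have "v k = P (k' - N)" using wrap[of "k' - N"] lt i k by simp
        moreover have "0 < det2 (P m - P (k' - N)) (P j' - P (k' - N))"
          using 2 lt i by (intro orient) auto
        ultimately show ?thesis using v_int 2 i j cyc by metis
      next
        case 3
        then have "v k = P (k' - N)" "v j = P (j' - N)"
          using wrap[of "k' - N"] wrap[of "j' - N"] lt i j k by simp_all
        moreover have "0 < det2 (P (k' - N) - P (j' - N)) (P m - P (j' - N))"
          using 3 lt i by (intro orient) auto
        ultimately show ?thesis using v_int i cyc by metis
      qed
    qed
  qed
  moreover have "range v = Y"
  proof -
    have "range v = P ` {..<N}"
    proof (intro equalityI subsetI)
      fix x assume "x \<in> range v"
      then obtain i where "x = v i" by blast
      then show "x \<in> P ` {..<N}" using repr[of i] v_int by auto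
    next
      fix x assume "x \<in> P ` {..<N}"
      then obtain m where "m < N" "x = P m" by auto
      then have "x = v (0 * n + int m)" using v_int[of m 0] by simp
      then show "x \<in> range v" by simp
    qed
    then show ?thesis using bij by (simp add: bij_betw_def)
  qed
  ultimately show ?thesis by (auto simp: n_def N_def)
qed

section \<open>Multiplicities of distances\<close>

theorem altman_complex:
  fixes Y :: "complex set"
  assumes "finite Y" "3 \<le> card Y" "\<forall>x\<in>Y. x \<notin> convex hull (Y - {x})"
    and D: "finite D" "2 * card D < card Y"
      "\<And>x y. x \<in> Y \<Longrightarrow> y \<in> Y \<Longrightarrow> x \<noteq> y \<Longrightarrow> dist x y \<in> D"
  shows "card Y = 2 * card D + 1"
    and "\<And>x \<delta>. x \<in> Y \<Longrightarrow> \<delta> \<in> D \<Longrightarrow> card {y \<in> Y. dist x y = \<delta>} = 2"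
proof -
  obtain v \<theta> where vt: "convex_polygon v \<theta> (int (card Y))" and Y: "range v = Y"
    using ex_convex_polygon[OF assms(1-3)] by blast
  interpret convex_polygon v \<theta> "int (card Y)" by (rule vt)
  have vY: "v i \<in> Y" for i using Y by auto
  interpret few_distances v \<theta> "int (card Y)" D
    by unfold_locales (use D vY in auto)
  show "card Y = 2 * card D + 1" using period_eq card_D_eq by simp
  show "card {y \<in> Y. dist x y = \<delta>} = 2" if x: "x \<in> Y" and \<delta>: "\<delta> \<in> D" for x \<delta>
  proof -
    obtain b where "x = v b" using Y x by auto
    then show ?thesis using card_at_distance[OF \<delta>, of b] Y by simp
  qed
qed

text \<open>The coordinate map \<open>f\<close> to the complex numbers is a linear isometry, so
  distances, hulls and cardinalities carry over from \<open>altman_complex\<close>.\<close>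

theorem altman:
  fixes X :: "(real^2) set"
  assumes fin: "finite X" and card: "3 \<le> card X" and conv: "convex_position X"
    and D: "finite D" "2 * card D < card X" "determined_distances X \<subseteq> D"
  shows "card X = 2 * card D + 1"
    and "\<And>x \<delta>. x \<in> X \<Longrightarrow> \<delta> \<in> D \<Longrightarrow> card {y \<in> X. dist x y = \<delta>} = 2"
proof -
  define f :: "real^2 \<Rightarrow> complex" where "f x = Complex (x $ 1) (x $ 2)" for x
  have "linear f" by (rule linearI) (simp_all add: f_def complex_eq_iff)
  have dist_f: "dist (f x) (f y) = dist x y" for x y
    by (simp add: f_def dist_norm cmod_def norm_vec_def L2_set_def sum_2)
  then have inj: "inj f" by (metis dist_eq_0_iff injI)
  have card_f: "card (f ` X) = card X" using inj by (simp add: card_image inj_on_subset)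
  have conv_f: "\<forall>z\<in>f ` X. z \<notin> convex hull (f ` X - {z})"
  proof
    fix z assume "z \<in> f ` X"
    then obtain x where x: "x \<in> X" "z = f x" by blast
    have "convex hull (f ` X - {z}) = f ` (convex hull (X - {x}))"
      using convex_hull_linear_image[OF \<open>linear f\<close>, of "X - {x}"] image_set_diff[OF inj, of X "{x}"] x
      by simp
    moreover have "x \<notin> convex hull (X - {x})" using conv x by (auto simp: convex_position_def)
    ultimately show "z \<notin> convex hull (f ` X - {z})"
      using inj x(2) by (auto simp: inj_def)
  qed
  have D_f: "dist z w \<in> D" if zw: "z \<in> f ` X" "w \<in> f ` X" "z \<noteq> w" for z w
  proof -
    obtain x y where xy: "x \<in> X" "y \<in> X" "z = f x" "w = f y" using zw by blast
    then have "dist x y \<in> determined_distances X"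
      using zw(3) by (auto simp: determined_distances_def)
    then show ?thesis using D(3) xy by (auto simp: dist_f)
  qed
  note A = altman_complex[of "f ` X" D, OF _ _ conv_f D(1) _ D_f, unfolded card_f]
  show "card X = 2 * card D + 1" using A(1) fin card D(2) by simp
  show "card {y \<in> X. dist x y = \<delta>} = 2" if "x \<in> X" "\<delta> \<in> D" for x \<delta>
  proof -
    have "{z \<in> f ` X. dist (f x) z = \<delta>} = f ` {y \<in> X. dist x y = \<delta>}"
      by (auto simp: dist_f)
    then have "card {z \<in> f ` X. dist (f x) z = \<delta>} = card {y \<in> X. dist x y = \<delta>}"
      using inj by (simp add: card_image inj_on_subset)
    moreover have "card {z \<in> f ` X. dist (f x) z = \<delta>} = 2"
      using A(2)[of "f x" \<delta>] fin card D(2) that by simp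
    ultimately show ?thesis by simp
  qed
qed

section \<open>Counting pairs by distance\<close>

lemma finite_determined_distances: "finite X \<Longrightarrow> finite (determined_distances X)"
  by (rule finite_subset[of _ "(\<lambda>(x, y). dist x y) ` (X \<times> X)"])
     (auto simp: determined_distances_def)

lemma convex_position_subset:
  assumes "convex_position X" "Y \<subseteq> X"
  shows "convex_position Y"
  unfolding convex_position_def
proof
  fix x assume "x \<in> Y"
  have "convex hull (Y - {x}) \<subseteq> convex hull (X - {x})"
    using assms(2) by (intro hull_mono) auto
  then show "x \<notin> convex hull (Y - {x})"
    using assms \<open>x \<in> Y\<close> by (auto simp: convex_position_def)
qed

definition distance_pairs :: "(real^2) set \<Rightarrow> real \<Rightarrow> (real^2) set set" where
  "distance_pairs X d = {{x, y} | x y. x \<in> X \<and> y \<in> X \<and> x \<noteq> y \<and> dist x y = d}"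

lemma dist_multiplicity_eq: "dist_multiplicity X d = card (distance_pairs X d)"
  by (simp add: dist_multiplicity_def distance_pairs_def)

lemma finite_distance_pairs: "finite X \<Longrightarrow> finite (distance_pairs X d)"
  by (rule finite_subset[of _ "Pow X"]) (auto simp: distance_pairs_def)

text \<open>Every pair of distinct points belongs to exactly one distance class.\<close>

lemma sum_dist_multiplicity:
  assumes "finite X"
  shows "(\<Sum>d\<in>determined_distances X. dist_multiplicity X d) = card X choose 2"
proof -
  have "(\<Union>d\<in>determined_distances X. distance_pairs X d) = {e. e \<subseteq> X \<and> card e = 2}"
    by (auto simp: distance_pairs_def determined_distances_def card_2_iff)
  moreover have "card (\<Union>d\<in>determined_distances X. distance_pairs X d)
      = (\<Sum>d\<in>determined_distances X. card (distance_pairs X d))"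
  proof (rule card_UN_disjoint)
    show "\<forall>i\<in>determined_distances X. \<forall>j\<in>determined_distances X.
        i \<noteq> j \<longrightarrow> distance_pairs X i \<inter> distance_pairs X j = {}"
      by (auto simp: distance_pairs_def doubleton_eq_iff dist_commute)
  qed (use assms finite_determined_distances finite_distance_pairs in auto)
  ultimately show ?thesis using n_subsets[OF assms, of 2] by (simp add: dist_multiplicity_eq)
qed

text \<open>Handshake count of incidences; \<open>0 < d\<close> keeps a point from being paired with
  itself.\<close>

lemma sum_degrees:
  assumes "finite X" "0 < d"
  shows "(\<Sum>x\<in>X. card {y \<in> X. dist x y = d}) = 2 * dist_multiplicity X d"
proof -
  have deg: "card {e \<in> distance_pairs X d. x \<in> e} = card {y \<in> X. dist x y = d}" if "x \<in> X" for x
  proof -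
    have "{e \<in> distance_pairs X d. x \<in> e} = (\<lambda>y. {x, y}) ` {y \<in> X. dist x y = d}"
    proof (intro equalityI subsetI)
      fix e assume "e \<in> {e \<in> distance_pairs X d. x \<in> e}"
      then obtain a b where ab: "e = {a, b}" "a \<in> X" "b \<in> X" "dist a b = d" "x = a \<or> x = b"
        by (auto simp: distance_pairs_def)
      then show "e \<in> (\<lambda>y. {x, y}) ` {y \<in> X. dist x y = d}"
        by (auto simp: dist_commute insert_commute)
    next
      fix e assume "e \<in> (\<lambda>y. {x, y}) ` {y \<in> X. dist x y = d}"
      then obtain y where "e = {x, y}" "y \<in> X" "dist x y = d" by blast
      moreover from this have "x \<noteq> y" using assms(2) by auto
      ultimately show "e \<in> {e \<in> distance_pairs X d. x \<in> e}"
        using that unfolding distance_pairs_def by blast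
    qed
    moreover have "inj_on (\<lambda>y. {x, y}) {y \<in> X. dist x y = d}"
      by (auto simp: inj_on_def doubleton_eq_iff)
    ultimately show ?thesis by (simp add: card_image)
  qed
  have "card {x \<in> X. x \<in> e} = 2" if "e \<in> distance_pairs X d" for e
  proof -
    have "{x \<in> X. x \<in> e} = e" "card e = 2" using that by (auto simp: distance_pairs_def)
    then show ?thesis by simp
  qed
  then have "(\<Sum>x\<in>X. card {e \<in> distance_pairs X d. x \<in> e}) = 2 * card (distance_pairs X d)"
    using assms(1) finite_distance_pairs by (intro sum_multicount) auto
  then show ?thesis using deg by (simp add: dist_multiplicity_eq)
qed

text \<open>Of three collinear points one lies between the other two, hence in their convex
  hull.\<close>

lemma convex_position_not_collinear:
  assumes "convex_position X" "a \<in> X" "b \<in> X" "c \<in> X" "a \<noteq> b" "b \<noteq> c" "a \<noteq> c"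
  shows "\<not> collinear {a, b, c}"
proof
  have *: False if "between (q, r) p" "p \<in> X" "q \<in> X" "r \<in> X" "p \<noteq> q" "p \<noteq> r" for p q r
  proof -
    have "p \<in> convex hull {q, r}" using that(1) by (simp add: between_mem_segment segment_convex_hull)
    also have "\<dots> \<subseteq> convex hull (X - {p})" using that by (intro hull_mono) auto
    finally show False using assms(1) that(2) by (auto simp: convex_position_def)
  qed
  assume "collinear {a, b, c}"
  then show False using *[of b c a] *[of c a b] *[of a b c] assms
    by (auto simp: collinear_between_cases)
qed

text \<open>\<open>S\<close> lies on the perpendicular bisector of \<open>u\<close> and
  \<open>w\<close>, whose direction is \<open>w - u\<close> turned by a right angle.\<close>

lemma collinear_equidistant:
  fixes u w :: "real^2"
  assumes "u \<noteq> w" "\<And>x. x \<in> S \<Longrightarrow> dist x u = dist x w"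
  shows "collinear S"
proof -
  define c where "c = w - u"
  have c: "c $ 1 \<noteq> 0 \<or> c $ 2 \<noteq> 0" using assms(1) by (auto simp: c_def vec_eq_iff forall_2)
  have bis: "2 * (x \<bullet> c) = w \<bullet> w - u \<bullet> u" if "x \<in> S" for x
  proof -
    have "(dist x u)\<^sup>2 = (dist x w)\<^sup>2" using assms(2)[OF that] by simp
    then show ?thesis
      by (simp add: dist_norm power2_norm_eq_inner c_def inner_diff inner_commute algebra_simps)
  qed
  have "\<exists>k. x - y = k *\<^sub>R (\<chi> i. if i = 1 then - c $ 2 else c $ 1)" if "x \<in> S" "y \<in> S" for x y
  proof -
    have "(x - y) \<bullet> c = 0" using bis[OF that(1)] bis[OF that(2)] by (simp add: inner_diff_left)
    then have eq: "(x - y) $ 1 * c $ 1 + (x - y) $ 2 * c $ 2 = 0" by (simp add: inner_vec_def sum_2)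
    show ?thesis
    proof (cases "c $ 1 = 0")
      case True
      then show ?thesis
        using c eq by (intro exI[of _ "- (x - y) $ 1 / c $ 2"]) (auto simp: vec_eq_iff forall_2 field_simps)
    next
      case False
      then show ?thesis
        using eq by (intro exI[of _ "(x - y) $ 2 / c $ 1"]) (auto simp: vec_eq_iff forall_2 field_simps)
    qed
  qed
  then show ?thesis unfolding collinear_def by blast
qed

text \<open>Every remaining point has degree 2 in each distance graph of both \<open>X - {u}\<close> and \<open>X - {w}\<close>;
  so the degree 3 at the distance to \<open>u\<close> must be due to \<open>w\<close>.\<close>

lemma altman_remove_two:
  assumes fin: "finite X" and card: "5 \<le> card X" and conv: "convex_position X"
    and uw: "u \<in> X" "w \<in> X" "u \<noteq> w"
    and D: "finite D" "2 * card D + 1 < card X"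
      "determined_distances (X - {u}) \<subseteq> D" "determined_distances (X - {w}) \<subseteq> D"
  shows False
proof -
  \<comment> \<open>After one deletion \<open>card X - 1\<close> points remain, still more than
    \<open>2 * card D\<close>.\<close>
  have deg: "card {y \<in> X - {z}. dist x y = \<delta>} = 2"
    if "z \<in> {u, w}" "x \<in> X - {z}" "\<delta> \<in> D" for z x \<delta>
  proof (rule altman(2)[of "X - {z}" D])
    show "convex_position (X - {z})" using conv by (rule convex_position_subset) auto
    show "determined_distances (X - {z}) \<subseteq> D" using that D by auto
  qed (use that fin card uw D in auto)
  have equi: "dist x u = dist x w" if x: "x \<in> X - {u, w}" for x
  proof (rule ccontr)
    assume neq: "dist x u \<noteq> dist x w"
    let ?\<delta> = "dist x u"
    have \<delta>: "?\<delta> \<in> D" using D(4) x uw by (auto simp: determined_distances_def)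
    have "{y \<in> X - {w}. dist x y = ?\<delta>} = insert u {y \<in> X - {u}. dist x y = ?\<delta>}"
      using neq uw by auto
    then have "card {y \<in> X - {w}. dist x y = ?\<delta>} = Suc (card {y \<in> X - {u}. dist x y = ?\<delta>})"
      using fin by simp
    then show False using deg[of u x ?\<delta>] deg[of w x ?\<delta>] x \<delta> by simp
  qed
  have "3 \<le> card (X - {u, w})" using card fin uw by (simp add: card_Diff_subset)
  then obtain T where T: "T \<subseteq> X - {u, w}" "card T = 3"
    using obtain_subset_with_card_n by metis
  then obtain a b c where abc: "T = {a, b, c}" "a \<noteq> b" "b \<noteq> c" "a \<noteq> c" by (auto simp: card_3_iff)
  have "collinear T" using T by (intro collinear_equidistant[OF uw(3)] equi) auto
  then show False using convex_position_not_collinear[OF conv, of a b c] T abc by auto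
qed

theorem theorem1p2:
  fixes n :: nat and X :: "(real^2) set"
  assumes "n \<ge> 5" and "finite X" and "card X = n" and "convex_position X"
  shows "\<not> (\<forall>d \<in> determined_distances X - {diameter X}. dist_multiplicity X d > n)"
proof
  let ?D = "determined_distances X"
  let ?m = "dist_multiplicity X"
  assume large: "\<forall>d \<in> ?D - {diameter X}. ?m d > n"
  have fin_D: "finite ?D" using assms(2) by (rule finite_determined_distances)
  obtain a b where "a \<in> X" "b \<in> X" "a \<noteq> b"
    using card_le_Suc0_iff_eq[OF assms(2)] assms(1,3) by auto
  then have ne: "?D \<noteq> {}" by (auto simp: determined_distances_def)
  have diam: "diameter X \<in> ?D"
    using diameter_eq_Max_determined_distances[of X] Max_in[OF fin_D ne] assms by simp
  then obtain u w where uw: "u \<in> X" "w \<in> X" "u \<noteq> w" "dist u w = diameter X"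
    by (auto simp: determined_distances_def)
  have "1 \<le> ?m (diameter X)"
  proof -
    have "distance_pairs X (diameter X) \<noteq> {}" using uw by (auto simp: distance_pairs_def)
    then show ?thesis
      using finite_distance_pairs[OF assms(2)] by (simp add: dist_multiplicity_eq Suc_le_eq card_gt_0_iff)
  qed
  define k where "k = card ?D"
  have k: "1 \<le> k" using ne fin_D by (simp add: k_def Suc_le_eq card_gt_0_iff)
  have "(k - 1) * (n + 1) \<le> (\<Sum>d\<in>?D - {diameter X}. ?m d)"
  proof -
    have "card (?D - {diameter X}) = k - 1" using diam by (simp add: k_def)
    moreover have "card (?D - {diameter X}) * (n + 1) \<le> (\<Sum>d\<in>?D - {diameter X}. ?m d)"
      using large by (intro sum_bounded_below[where 'a = nat, simplified]) (auto simp: Suc_le_eq)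
    ultimately show ?thesis by simp
  qed
  then have "(k - 1) * (n + 1) + ?m (diameter X) \<le> n choose 2"
    using sum_dist_multiplicity[OF assms(2)] assms(3) sum.remove[OF fin_D diam, of ?m] by simp
  then have le: "2 * ((k - 1) * (n + 1) + ?m (diameter X)) \<le> n * (n - 1)"
    by (simp add: choose_two)
  \<comment> \<open>Over the integers, where \<open>k - 1\<close> and \<open>n - 1\<close> are not
    truncated.\<close>
  have count: "2 * (int k - 1) * (int n + 1) + 2 * int (?m (diameter X)) \<le> int n * (int n - 1)"
  proof -
    have "int (k - 1) = int k - 1" "int (n - 1) = int n - 1" using k assms(1) by auto
    moreover have "int (2 * ((k - 1) * (n + 1) + ?m (diameter X))) \<le> int (n * (n - 1))"
      using le by (simp only: of_nat_le_iff)
    ultimately show ?thesis by (simp only: of_nat_mult of_nat_add of_nat_numeral of_nat_1 distrib_left mult.assoc)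
  qed
  \<comment> \<open>Otherwise \<open>count\<close> would give
    \<open>n^2 - 1 + 2 \<le> n^2 - n\<close>.\<close>
  have "2 * k \<le> n"
  proof (rule ccontr)
    assume "\<not> 2 * k \<le> n"
    then have "int n - 1 \<le> 2 * (int k - 1)" by simp
    then have "(int n - 1) * (int n + 1) \<le> 2 * (int k - 1) * (int n + 1)"
      by (rule mult_right_mono) simp
    then show False using count \<open>1 \<le> ?m (diameter X)\<close> by (simp add: algebra_simps)
  qed
  show False
  proof (cases "odd n")
    case True
    then have "2 * k < n" using \<open>2 * k \<le> n\<close> by (metis even_mult_iff even_numeral le_neq_implies_less)
    then have "n = 2 * k + 1"
      and deg: "\<And>x \<delta>. x \<in> X \<Longrightarrow> \<delta> \<in> ?D \<Longrightarrow> card {y \<in> X. dist x y = \<delta>} = 2"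
      using altman[of X ?D] assms fin_D by (auto simp: k_def)
    \<comment> \<open>From \<open>n \<ge> 5\<close> it follows that \<open>k \<ge> 2\<close>, so
      there is a distance other than the diameter.\<close>
    then have "card (?D - {diameter X}) \<noteq> 0" using assms(1) diam by (simp add: k_def)
    then obtain \<delta> where \<delta>: "\<delta> \<in> ?D - {diameter X}" by (metis card.empty ex_in_conv)
    then have "0 < \<delta>" by (auto simp: determined_distances_def)
    then have "2 * ?m \<delta> = 2 * n"
      using sum_degrees[OF assms(2), of \<delta>] deg \<delta> assms(3) by simp
    then show False using large \<delta> by auto
  next
    case False
    show False
    proof (cases "2 * k = n")
      case True
      \<comment> \<open>Here \<open>2 * (k - 1) * (n + 1) = n^2 - n - 2\<close>, so
        \<open>count\<close> leaves room for a single diametral pair.\<close>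
      then have "2 * (int k - 1) = int n - 2" by simp
      then have "int (?m (diameter X)) \<le> 1" using count by (simp add: algebra_simps)
      then have one: "card (distance_pairs X (diameter X)) \<le> 1" by (simp add: dist_multiplicity_eq)
      have only: "{x, y} = {u, w}" if "x \<in> X" "y \<in> X" "x \<noteq> y" "dist x y = diameter X" for x y
      proof -
        have "{x, y} \<in> distance_pairs X (diameter X)" "{u, w} \<in> distance_pairs X (diameter X)"
          using that uw by (auto simp: distance_pairs_def)
        then show ?thesis
          using one finite_distance_pairs[OF assms(2)] by (metis One_nat_def card_le_Suc0_iff_eq)
      qed
      \<comment> \<open>Deleting either end of the only diametral pair removes the diameter from the
        distances, leaving at most \<open>k - 1\<close>.\<close>
      have sub: "determined_distances (X - {z}) \<subseteq> ?D - {diameter X}" if "z \<in> {u, w}" for z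
        using only that by (fastforce simp: determined_distances_def doubleton_eq_iff)
      have "card (?D - {diameter X}) = k - 1" using diam by (simp add: k_def)
      then have "2 * card (?D - {diameter X}) + 1 < n" using True k by simp
      then show False
        using altman_remove_two[OF assms(2) _ assms(4) uw(1-3), of "?D - {diameter X}"]
          assms(1,3) fin_D sub by simp
    next
      case neq: False
      \<comment> \<open>\<open>n\<close> is even, so \<open>2 * k < n\<close> leaves a gap of at
        least two, and all of \<open>?D\<close> can be kept after a deletion.\<close>
      then have "2 * k + 1 < n"
        using \<open>2 * k \<le> n\<close> False by presburger
      moreover have "determined_distances (X - {z}) \<subseteq> ?D" for z
        by (auto simp: determined_distances_def)
      ultimately show False
        using altman_remove_two[OF assms(2) _ assms(4) uw(1-3), of ?D] assms(1,3) fin_D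
        by (simp add: k_def)
    qed
  qed
qed

end
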